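(* Let $q,\widetilde q\in C^1[0,1]$ be real-valued functions and let $a_{11},a_{12},a_{21},a_{22}$ and $\widetilde a_{11},\widetilde a_{12},\widetilde a_{21},\widetilde a_{22}$ be real constants. Let $L,L_1,L_2$ be the eigenvalue problems (defined in the context) associated with $(q,a_{11},a_{12},a_{21},a_{22})$, with eigenvalues $\lambda_k,\ \lambda_{k,1},\ \lambda_{k,2}$ ($k=0,1,2,\dots$) respectively, and let $\widetilde L,\widetilde L_1,\widetilde L_2$ be the corresponding problems associated with $(\widetilde q,\widetilde a_{11},\widetilde a_{12},\widetilde a_{21},\widetilde a_{22})$, with eigenvalues $\widetilde\lambda_k,\ \widetilde\lambda_{k,1},\ \widetilde\lambda_{k,2}$ ($k=0,1,2,\dots$) respectively. Suppose that for all $k=0,1,2,\dots$ $$\lambda_k=\widetilde\lambda_k,\qquad \lambda_{k,1}=\widetilde\lambda_{k,1},\qquad \lambda_{k,2}=\widetilde\lambda_{k,2},$$ and that $a_{12}\neq a_{22}$. Then the coefficients of the equations and the constants in the boundary conditions of $L$ and $\widetilde L$ coincide, that is, $q(x)=\widetilde q(x)$ for all $x\in[0,1]$ and $a_{ij}=\widetilde a_{ij}$ for $i,j=1,2$.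
   Context: Given a real-valued $q\in C^1[0,1]$ and real constants $a_{11},a_{12},a_{21},a_{22}$, consider on $[0,1]$ the differential equation $$-y''+q(x)\,y=\lambda y$$ with spectral parameter $\lambda$, together with three different pairs of boundary conditions. Problem $L$ (boundary conditions mixing the two endpoints): the equation with $$y'(0)+a_{11}y(0)+a_{12}y(1)=0,\qquad y'(1)+a_{21}y(0)+a_{22}y(1)=0.$$ Problem $L_1$: the equation with $$y'(0)+a_{11}y(0)=0,\qquad y'(1)+a_{22}y(1)=0.$$ Problem $L_2$: the equation with $$y'(0)+a_{11}y(0)=0,\qquad y'(1)+a_{12}y(1)=0.$$ (The same constant $a_{12}$ that appears in the first boundary condition of $L$ is used at the endpoint $1$ in $L_2$.) An eigenvalue of one of these problems is a number $\lambda\in\mathbb{C}$ for which the problem has a nonzero solution $y$. The eigenvalues of $L,L_1,L_2$ are denoted $\lambda_k,\lambda_{k,1},\lambda_{k,2}$, $k=0,1,2,\dots$, respectively. They are listed with multiplicity, the multiplicity being that of $\lambda$ as a zero of the characteristic determinant of the problem. For boundary forms $U_1,U_2$ this determinant is $$\Delta(\lambda)=\det\begin{pmatrix} U_1(y_1(\cdot,\lambda)) & U_1(y_2(\cdot,\lambda)) \\ U_2(y_1(\cdot,\lambda)) & U_2(y_2(\cdot,\lambda)) \end{pmatrix},$$ where $y_1,y_2$ are the solutions of the equation with $y_1(0,\lambda)=1$, $y_1'(0,\lambda)=0$, $y_2(0,\lambda)=0$, $y_2'(0,\lambda)=1$. Equality of the eigenvalues of two problems for all $k$ means that the two lists coincide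 as multisets. A tilde denotes the analogous object built from $\widetilde q$ and $\widetilde a_{ij}$ in place of $q$ and $a_{ij}$. *)

theory Defs
  imports "HOL-Complex_Analysis.Complex_Analysis"
begin

definition C1_unit_interval :: "(real \<Rightarrow> real) \<Rightarrow> bool" where
  "C1_unit_interval q \<longleftrightarrow>
     (\<exists>q'. (\<forall>x\<in>{0..1}. (q has_real_derivative q' x) (at x within {0..1})) \<and>
           continuous_on {0..1} q')"

text \<open>Derivatives are taken within the closed interval, hence one-sided at 0 and 1; values of
  functions outside the interval never matter.\<close>

definition deriv01 :: "(real \<Rightarrow> complex) \<Rightarrow> real \<Rightarrow> complex" where
  "deriv01 y x = vector_derivative y (at x within {0..1})"

text \<open>Solutions of \<open>- y'' + q y = z y\<close>, read as \<open>y'' = (q - z) y\<close>.\<close>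

definition solves :: "(real \<Rightarrow> real) \<Rightarrow> complex \<Rightarrow> (real \<Rightarrow> complex) \<Rightarrow> bool" where
  "solves q z y \<longleftrightarrow>
     (\<forall>x\<in>{0..1}. (y has_vector_derivative deriv01 y x) (at x within {0..1}) \<and>
                  (deriv01 y has_vector_derivative (complex_of_real (q x) - z) * y x)
                    (at x within {0..1}))"

text \<open>The initial value problem determines \<open>y\<close> on the unit interval only; the choice made by
  \<open>SOME\<close> concerns the irrelevant values outside it.\<close>

definition ivp_solution ::
    "(real \<Rightarrow> real) \<Rightarrow> complex \<Rightarrow> complex \<Rightarrow> complex \<Rightarrow> real \<Rightarrow> complex" where
  "ivp_solution q z c d = (SOME y. solves q z y \<and> y 0 = c \<and> deriv01 y 0 = d)"

type_synonym boundary_form = "(real \<Rightarrow> complex) \<Rightarrow> complex"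

definition char_det ::
    "(real \<Rightarrow> real) \<Rightarrow> boundary_form \<Rightarrow> boundary_form \<Rightarrow> complex \<Rightarrow> complex" where
  "char_det q U1 U2 z =
     (let y1 = ivp_solution q z 1 0; y2 = ivp_solution q z 0 1
      in det (vector [vector [U1 y1, U1 y2], vector [U2 y1, U2 y2]] :: complex^2^2))"

definition eigenvalue ::
    "(real \<Rightarrow> real) \<Rightarrow> boundary_form \<Rightarrow> boundary_form \<Rightarrow> complex \<Rightarrow> bool" where
  "eigenvalue q U1 U2 z \<longleftrightarrow>
     (\<exists>y. solves q z y \<and> (\<exists>x\<in>{0..1}. y x \<noteq> 0) \<and> U1 y = 0 \<and> U2 y = 0)"

text \<open>The sequence lists exactly the eigenvalues, in any order, each one as often as its order as
  a zero of the characteristic determinant.\<close>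

definition eigenvalue_list ::
    "(real \<Rightarrow> real) \<Rightarrow> boundary_form \<Rightarrow> boundary_form \<Rightarrow> (nat \<Rightarrow> complex) \<Rightarrow> bool" where
  "eigenvalue_list q U1 U2 ev \<longleftrightarrow>
     range ev = {z. eigenvalue q U1 U2 z} \<and>
     (\<forall>z. eigenvalue q U1 U2 z \<longrightarrow>
          finite {k. ev k = z} \<and> int (card {k. ev k = z}) = zorder (char_det q U1 U2) z)"

text \<open>Equality as multisets: equality for all indices after a reordering.\<close>

definition same_multiset :: "(nat \<Rightarrow> 'a) \<Rightarrow> (nat \<Rightarrow> 'a) \<Rightarrow> bool" where
  "same_multiset u v \<longleftrightarrow> (\<exists>p. bij p \<and> (\<forall>k. u k = v (p k)))"

definition form_mixed0 :: "real \<Rightarrow> real \<Rightarrow> boundary_form" where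
  "form_mixed0 a b y = deriv01 y 0 + of_real a * y 0 + of_real b * y 1"

definition form_mixed1 :: "real \<Rightarrow> real \<Rightarrow> boundary_form" where
  "form_mixed1 a b y = deriv01 y 1 + of_real a * y 0 + of_real b * y 1"

definition form0 :: "real \<Rightarrow> boundary_form" where
  "form0 a y = deriv01 y 0 + of_real a * y 0"

definition form1 :: "real \<Rightarrow> boundary_form" where
  "form1 a y = deriv01 y 1 + of_real a * y 1"

definition eigenvalues_L ::
    "(real \<Rightarrow> real) \<Rightarrow> real \<Rightarrow> real \<Rightarrow> real \<Rightarrow> real \<Rightarrow> (nat \<Rightarrow> complex) \<Rightarrow> bool" where
  "eigenvalues_L q a11 a12 a21 a22 =
     eigenvalue_list q (form_mixed0 a11 a12) (form_mixed1 a21 a22)"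

definition eigenvalues_L1 ::
    "(real \<Rightarrow> real) \<Rightarrow> real \<Rightarrow> real \<Rightarrow> real \<Rightarrow> real \<Rightarrow> (nat \<Rightarrow> complex) \<Rightarrow> bool" where
  "eigenvalues_L1 q a11 a12 a21 a22 = eigenvalue_list q (form0 a11) (form1 a22)"

text \<open>Here \<open>a12\<close>, not \<open>a22\<close>, is the constant at the endpoint 1.\<close>

definition eigenvalues_L2 ::
    "(real \<Rightarrow> real) \<Rightarrow> real \<Rightarrow> real \<Rightarrow> real \<Rightarrow> real \<Rightarrow> (nat \<Rightarrow> complex) \<Rightarrow> bool" where
  "eigenvalues_L2 q a11 a12 a21 a22 = eigenvalue_list q (form0 a11) (form1 a12)"

end

theory Submission
  imports Defs "HOL-Real_Asymp.Real_Asymp"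
begin

text \<open>
  The constant \<open>a12\<close> enters \<open>L2\<close> in the place of \<open>a22\<close>, so \<open>L1\<close> and \<open>L2\<close> are two separated problems
  that differ only in the condition at the right endpoint. Their spectra determine \<open>q\<close>, \<open>a11\<close>, \<open>a22\<close>
  and \<open>a12\<close> (the two-spectra theorem of Borg), and then the spectrum of \<open>L\<close> yields \<open>a21\<close>.

  Write \<open>z = \<rho>\<^sup>2\<close>. A solution of \<open>y'' = (q - \<rho>\<^sup>2) y\<close> with \<open>y 0 = c\<close> equals \<open>c * cos (\<rho> x)\<close> up to an
  error of order \<open>exp (x * \<bar>Im \<rho>\<bar>) / \<rho>\<close> (\<open>solution_asymptotics\<close>). Consequently every characteristic
  determinant below is an entire function of \<open>z\<close> of the form \<open>\<rho> * sin \<rho> + O(exp \<bar>Im \<rho>\<bar>)\<close>. All of the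
  complex analysis is one principle, \<open>entire_eq_0_by_sine_type_division\<close>: if \<open>W\<close> has this form, \<open>F\<close> is
  entire and \<open>F * W = O(exp \<bar>Im \<rho>\<bar>)\<close>, then \<open>F = 0\<close>. Indeed \<open>sin \<rho>\<close> is bounded below by a multiple of
  \<open>exp \<bar>Im \<rho>\<bar>\<close> on the boundaries of the squares with half-width \<open>\<pi> * (n + 1/2)\<close>, so that \<open>F = O(1/\<rho>)\<close>
  there, and the maximum principle applies.

  Firstly, this principle shows that a determinant is determined by its zeros with multiplicities:
  the quotient \<open>h\<close> of two determinants \<open>f\<close>, \<open>g\<close> with the same zeros is entire, and \<open>(h - 1) * g = f - g\<close>
  is \<open>O(exp \<bar>Im \<rho>\<bar>)\<close>, so \<open>h = 1\<close>.

  Secondly, let \<open>\<phi>\<close> be the solution with \<open>\<phi> 0 = 1\<close>, \<open>\<phi>' 0 = - a11\<close>. The determinants of \<open>L1\<close> and \<open>L2\<close> are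
  \<open>- (\<phi>' 1 + a22 * \<phi> 1)\<close> and \<open>- (\<phi>' 1 + a12 * \<phi> 1)\<close>. Their difference is \<open>(a12 - a22) * \<phi> 1\<close>;
  since \<open>\<phi> 1\<close> behaves like \<open>cos \<rho>\<close>, the constant factor is known, and as it is nonzero, so is \<open>\<phi> 1\<close> for
  all \<open>z\<close>.
  So the two problems have the same \<open>\<phi> 1\<close> and the same \<open>W = - (\<phi>' 1 + a22 * \<phi> 1)\<close>.

  Thirdly, a mixed Wronskian argument in the spirit of Levinson applies
  (\<open>cauchy_data_determine_solution\<close>). Let \<open>\<psi>\<close> and \<open>s\<close> be the solutions with \<open>\<psi> 1 = 1\<close>, \<open>\<psi>' 1 = - a22\<close> and
  \<open>s 1 = 0\<close>, \<open>s' 1 = 1\<close>, so that \<open>\<phi> = \<phi> 1 * \<psi> - W * s\<close>; mark the objects of the second problem by \<open>t\<close>.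
  Then \<open>\<phi> * \<psi>t' - \<phi>t' * \<psi> = W * (\<psi> * st' - s * \<psi>t')\<close> and \<open>\<phi> * \<psi>t - \<phi>t * \<psi> = W * (\<psi> * st - s * \<psi>t)\<close>,
  where the brackets are entire in \<open>z\<close>. The asymptotics and the division principle show that the first
  bracket is \<open>1\<close> and the second is \<open>0\<close>. Linear algebra now gives \<open>\<phi> = \<phi>t\<close>, and the differential equation
  gives \<open>q = qt\<close>.

  Finally, the determinant of \<open>L\<close> is \<open>W + a12 - a21 - a12 * a21 * S 1\<close> with \<open>S 0 = 0\<close>, \<open>S' 0 = 1\<close>. With all
  else known, equality of two such determinants means \<open>(a21 - at21) * (1 + a12 * S 1) = 0\<close>, and \<open>S 1\<close>
  tends to \<open>0\<close> along real \<open>\<rho>\<close>.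
\<close>

section \<open>Solutions of the differential equation\<close>

lemma deriv01_eqI:
  assumes "x \<in> {0..1}" "(y has_vector_derivative v) (at x within {0..1})"
  shows "deriv01 y x = v"
  unfolding deriv01_def using vector_derivative_within_closed_interval[OF _ assms] by simp

lemma deriv01_cong:
  assumes "\<And>x. x \<in> {0..1} \<Longrightarrow> y1 x = y2 x" "x \<in> {0..1}"
  shows "deriv01 y1 x = deriv01 y2 x"
proof -
  have "(y1 has_vector_derivative v) (at x within {0..1}) \<longleftrightarrow>
        (y2 has_vector_derivative v) (at x within {0..1})" for v
    using assms by (metis has_vector_derivative_transform)
  thus ?thesis
    by (simp add: deriv01_def vector_derivative_def)
qed

lemma solves_derivs:
  assumes "solves q z y" "x \<in> {0..1}"
  shows "(y has_vector_derivative deriv01 y x) (at x within {0..1})"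
    and "(deriv01 y has_vector_derivative (complex_of_real (q x) - z) * y x) (at x within {0..1})"
  using assms by (auto simp: solves_def)

lemma solvesI:
  assumes y: "\<And>x. x \<in> {0..1} \<Longrightarrow> (y has_vector_derivative v x) (at x within {0..1})"
    and v: "\<And>x. x \<in> {0..1} \<Longrightarrow>
      (v has_vector_derivative (complex_of_real (q x) - z) * y x) (at x within {0..1})"
  shows "solves q z y" and "\<And>x. x \<in> {0..1} \<Longrightarrow> deriv01 y x = v x"
proof -
  show *: "deriv01 y x = v x" if "x \<in> {0..1}" for x
    using deriv01_eqI[OF that y[OF that]] .
  show "solves q z y"
    unfolding solves_def using y v *
    by (auto intro: has_vector_derivative_transform[OF _ _ v])
qed

lemma solves_continuous:
  assumes "solves q z y"
  shows "continuous_on {0..1} y" "continuous_on {0..1} (deriv01 y)"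
  using solves_derivs[OF assms]
  by (meson continuous_on_eq_continuous_within has_vector_derivative_continuous)+

lemma solves_linear:
  assumes "solves q z y1" "solves q z y2"
  shows "solves q z (\<lambda>x. a * y1 x + b * y2 x)"
    and "\<And>x. x \<in> {0..1} \<Longrightarrow>
           deriv01 (\<lambda>x. a * y1 x + b * y2 x) x = a * deriv01 y1 x + b * deriv01 y2 x"
proof -
  note 1 = solves_derivs[OF assms(1)] and 2 = solves_derivs[OF assms(2)]
  have A: "((\<lambda>x. a * y1 x + b * y2 x) has_vector_derivative (a * deriv01 y1 x + b * deriv01 y2 x))
              (at x within {0..1})" if "x \<in> {0..1}" for x
    by (intro derivative_intros has_vector_derivative_mult_right 1 2 that)
  have B: "((\<lambda>x. a * deriv01 y1 x + b * deriv01 y2 x) has_vector_derivative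
             (complex_of_real (q x) - z) * (a * y1 x + b * y2 x)) (at x within {0..1})"
    if "x \<in> {0..1}" for x
  proof -
    have "((\<lambda>x. a * deriv01 y1 x + b * deriv01 y2 x) has_vector_derivative
             (a * ((complex_of_real (q x) - z) * y1 x) + b * ((complex_of_real (q x) - z) * y2 x)))
             (at x within {0..1})"
      by (intro derivative_intros has_vector_derivative_mult_right 1 2 that)
    thus ?thesis by (simp add: algebra_simps)
  qed
  show "solves q z (\<lambda>x. a * y1 x + b * y2 x)"
    and "\<And>x. x \<in> {0..1} \<Longrightarrow>
           deriv01 (\<lambda>x. a * y1 x + b * y2 x) x = a * deriv01 y1 x + b * deriv01 y2 x"
    using solvesI[OF A B] by auto
qed

lemma has_vector_derivative_reflect:
  fixes f :: "real \<Rightarrow> complex"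
  assumes "(f has_vector_derivative d) (at (1 - x) within {0..1})" "x \<in> {0..1}"
  shows "((\<lambda>x. f (1 - x)) has_vector_derivative - d) (at x within {0..1})"
proof -
  have im: "(\<lambda>x::real. 1 - x) ` {0..1} = {0..1}"
  proof -
    have "y \<in> (\<lambda>x::real. 1 - x) ` {0..1}" if "y \<in> {0..1}" for y :: real
      using that by (intro image_eqI[of _ _ "1 - y"]) auto
    thus ?thesis by auto
  qed
  have "((\<lambda>x::real. 1 - x) has_vector_derivative -1) (at x within {0..1})"
    by (auto intro!: derivative_eq_intros)
  from vector_diff_chain_within[OF this, of f d] assms show ?thesis
    by (simp add: o_def im)
qed

text \<open>Reflecting the interval turns statements about data at 0 into statements about data at 1.\<close>
lemma solves_reflect:
  assumes "solves q z y"
  shows "solves (\<lambda>x. q (1 - x)) z (\<lambda>x. y (1 - x))"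
    and "\<And>x. x \<in> {0..1} \<Longrightarrow> deriv01 (\<lambda>x. y (1 - x)) x = - deriv01 y (1 - x)"
proof -
  have A: "((\<lambda>x. y (1 - x)) has_vector_derivative - deriv01 y (1 - x)) (at x within {0..1})"
    if "x \<in> {0..1}" for x
    using that by (intro has_vector_derivative_reflect solves_derivs[OF assms]) auto
  have B: "((\<lambda>x. - deriv01 y (1 - x)) has_vector_derivative
      (complex_of_real (q (1 - x)) - z) * y (1 - x)) (at x within {0..1})" if "x \<in> {0..1}" for x
    using that has_vector_derivative_minus[OF has_vector_derivative_reflect[OF solves_derivs(2)[OF assms]]]
    by (auto simp: algebra_simps)
  show "solves (\<lambda>x. q (1 - x)) z (\<lambda>x. y (1 - x))"
    and "\<And>x. x \<in> {0..1} \<Longrightarrow> deriv01 (\<lambda>x. y (1 - x)) x = - deriv01 y (1 - x)"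
    using solvesI[OF A B] by auto
qed

text \<open>
  With the weight \<open>exp (K * t)\<close> each integration gains a factor \<open>1 / K\<close>. For large \<open>K\<close> this is a
  contraction, which gives both uniqueness and the convergence of the Picard series.
\<close>
lemma integral_exp_bound:
  fixes f :: "real \<Rightarrow> complex"
  assumes "continuous_on {0..1} f" "K > 0" "x \<in> {0..1}"
    and "\<And>t. t \<in> {0..1} \<Longrightarrow> norm (f t) \<le> B * exp (K * t)"
  shows "norm (integral {0..x} f) \<le> B / K * exp (K * x)"
proof -
  have B0: "B \<ge> 0" using order_trans[OF norm_ge_zero assms(4)[of 0]] by simp
  have "((\<lambda>t. B * exp (K * t)) has_integral (B / K * exp (K * x) - B / K * exp (K * 0))) {0..x}"
    using assms(2,3)
    by (intro fundamental_theorem_of_calculus)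
       (auto intro!: derivative_eq_intros simp flip: has_real_derivative_iff_has_vector_derivative)
  hence I: "((\<lambda>t. B * exp (K * t)) has_integral (B / K * exp (K * x) - B / K)) {0..x}" by simp
  have "norm (integral {0..x} f) \<le> integral {0..x} (\<lambda>t. B * exp (K * t))"
    using assms I
    by (intro integral_norm_bound_integral integrable_continuous_real
          continuous_on_subset[OF assms(1)]) (auto intro!: continuous_intros)
  also have "\<dots> = B / K * exp (K * x) - B / K" using I by (rule integral_unique)
  also have "\<dots> \<le> B / K * exp (K * x)" using B0 assms(2) by simp
  finally show ?thesis .
qed

text \<open>
  Let \<open>B\<close> be the maximum of \<open>(\<bar>y\<bar> + \<bar>y'\<bar>) * exp (- 4 * K * t)\<close>, where \<open>K\<close> bounds the coefficient.
  Integrating \<open>y'\<close> and \<open>y''\<close> once gains a factor 4 in each of the two summands, so \<open>B \<le> B / 2\<close>.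
\<close>
lemma solves_zero:
  assumes q: "continuous_on {0..1} q" and y: "solves q z y" "y 0 = 0" "deriv01 y 0 = 0"
    and x: "x \<in> {0..1}"
  shows "y x = 0"
proof -
  note d = solves_derivs[OF y(1)] and c = solves_continuous[OF y(1)]
  let ?Q = "\<lambda>t. complex_of_real (q t) - z"
  have cQ: "continuous_on {0..1} ?Q" by (intro continuous_intros q)
  hence "compact (?Q ` {0..1})" by (intro compact_continuous_image) auto
  then obtain K' where "\<forall>w\<in>?Q ` {0..1}. norm w \<le> K'"
    by (meson compact_imp_bounded bounded_iff)
  then obtain K where K: "K \<ge> 1" "\<And>t. t \<in> {0..1} \<Longrightarrow> norm (?Q t) \<le> K"
    by (metis image_eqI linorder_le_cases order_trans)
  let ?n = "\<lambda>t. (norm (y t) + norm (deriv01 y t)) * exp (- (4 * K * t))"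
  have "continuous_on {0..1} ?n" by (intro continuous_intros c)
  then obtain s where s: "s \<in> {0..1}" "\<And>t. t \<in> {0..1} \<Longrightarrow> ?n t \<le> ?n s"
    using continuous_attains_sup[of "{0..1::real}" ?n] by auto
  define B where "B = ?n s"
  have bd: "norm (y t) + norm (deriv01 y t) \<le> B * exp (4 * K * t)" if "t \<in> {0..1}" for t
  proof -
    have "norm (y t) + norm (deriv01 y t) = ?n t * exp (4 * K * t)"
      by (simp add: mult.assoc flip: exp_add)
    also have "\<dots> \<le> B * exp (4 * K * t)"
      using s(2)[OF that] unfolding B_def by (intro mult_right_mono) auto
    finally show ?thesis .
  qed
  have bd1: "norm (y t) \<le> B * exp (4 * K * t)" if "t \<in> {0..1}" for t
    using bd[OF that] norm_ge_zero[of "deriv01 y t"] by linarith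
  have bd2: "norm (deriv01 y t) \<le> B * exp (4 * K * t)" if "t \<in> {0..1}" for t
    using bd[OF that] norm_ge_zero[of "y t"] by linarith
  have "(deriv01 y has_integral (y s - y 0)) {0..s}"
    using s(1)
    by (intro fundamental_theorem_of_calculus has_vector_derivative_within_subset[OF d(1)]) auto
  hence e1: "y s = integral {0..s} (deriv01 y)" by (simp add: integral_unique y)
  have "((\<lambda>x. ?Q x * y x) has_integral (deriv01 y s - deriv01 y 0)) {0..s}"
    using s(1)
    by (intro fundamental_theorem_of_calculus has_vector_derivative_within_subset[OF d(2)]) auto
  hence e2: "deriv01 y s = integral {0..s} (\<lambda>x. ?Q x * y x)" by (simp add: integral_unique y)
  have "norm (y s) \<le> B / (4 * K) * exp (4 * K * s)"
    unfolding e1 using K(1) by (intro integral_exp_bound c s(1) bd2) auto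
  moreover have "norm (deriv01 y s) \<le> (K * B) / (4 * K) * exp (4 * K * s)"
    unfolding e2
  proof (intro integral_exp_bound s(1))
    show "norm (?Q t * y t) \<le> K * B * exp (4 * K * t)" if "t \<in> {0..1}" for t
      using mult_mono[OF K(2)[OF that] bd1[OF that]] K(1) by (simp add: norm_mult mult.assoc)
  qed (use K(1) in \<open>auto intro!: continuous_intros c q\<close>)
  moreover have "B / (4 * K) \<le> B / 4"
    using K(1) by (intro divide_left_mono) (auto simp: B_def)
  hence "B / (4 * K) * exp (4 * K * s) \<le> B / 4 * exp (4 * K * s)"
    by (rule mult_right_mono) simp
  moreover have "(K * B) / (4 * K) = B / 4" using K(1) by simp
  ultimately have "norm (y s) + norm (deriv01 y s) \<le> B / 2 * exp (4 * K * s)" by simp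
  hence "B \<le> B / 2 * exp (4 * K * s) * exp (- (4 * K * s))"
    unfolding B_def by (intro mult_right_mono) auto
  also have "\<dots> = B / 2" by (simp add: exp_minus)
  finally have "B \<le> 0" by simp
  hence "B * exp (4 * K * x) \<le> 0" by (simp add: mult_nonpos_nonneg)
  with bd1[OF x] have "norm (y x) \<le> 0" by linarith
  thus ?thesis by simp
qed

lemma solves_unique:
  assumes q: "continuous_on {0..1} q" and y: "solves q z y1" "solves q z y2"
    and 0: "y1 0 = y2 0" "deriv01 y1 0 = deriv01 y2 0" and x: "x \<in> {0..1}"
  shows "y1 x = y2 x" "deriv01 y1 x = deriv01 y2 x"
proof -
  note l = solves_linear[OF y, where a = 1 and b = "-1"]
  have *: "y1 x = y2 x" if "x \<in> {0..1}" for x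
  proof -
    have "deriv01 (\<lambda>x. 1 * y1 x + - 1 * y2 x) 0 = 0" by (subst l(2)) (auto simp: 0)
    from solves_zero[OF q l(1) _ this that] show ?thesis by (simp add: 0)
  qed
  show "y1 x = y2 x" using *[OF x] .
  show "deriv01 y1 x = deriv01 y2 x" by (intro deriv01_cong * x)
qed

lemma wronskian_constant:
  assumes y: "solves q z y1" "solves q z y2" and x: "x \<in> {0..1}"
  shows "y1 x * deriv01 y2 x - deriv01 y1 x * y2 x = y1 1 * deriv01 y2 1 - deriv01 y1 1 * y2 1"
proof -
  note 1 = solves_derivs[OF y(1)] and 2 = solves_derivs[OF y(2)]
  have "((\<lambda>x. y1 x * deriv01 y2 x - deriv01 y1 x * y2 x) has_vector_derivative 0) (at x within {0..1})"
    if "x \<in> {0..1}" for x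
    using has_vector_derivative_diff[OF
        has_vector_derivative_mult[OF 1(1)[OF that] 2(2)[OF that]]
        has_vector_derivative_mult[OF 1(2)[OF that] 2(1)[OF that]]]
    by (simp add: algebra_simps)
  hence "\<exists>c. \<forall>x\<in>{0..1}. y1 x * deriv01 y2 x - deriv01 y1 x * y2 x = c"
    by (intro has_derivative_zero_constant) (auto simp: has_vector_derivative_def)
  thus ?thesis using x by force
qed

section \<open>Existence and analytic dependence on the spectral parameter\<close>

text \<open>
  Functions that on the unit interval are polynomials in \<open>z\<close> with continuous coefficients. The class is
  generated inductively because its closure under integration then follows rule by rule; \<open>cong\<close> makes
  it independent of the values outside the interval.
\<close>
inductive z_polynomial :: "(complex \<Rightarrow> real \<Rightarrow> complex) \<Rightarrow> bool" where
  const: "continuous_on {0..1} g \<Longrightarrow> z_polynomial (\<lambda>z x. g x)"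
| add: "z_polynomial F \<Longrightarrow> z_polynomial G \<Longrightarrow> z_polynomial (\<lambda>z x. F z x + G z x)"
| times_z: "z_polynomial F \<Longrightarrow> z_polynomial (\<lambda>z x. z * F z x)"
| cong: "z_polynomial F \<Longrightarrow> (\<And>z x. x \<in> {0..1} \<Longrightarrow> G z x = F z x) \<Longrightarrow> z_polynomial G"

lemma z_polynomial_continuous: "z_polynomial F \<Longrightarrow> continuous_on {0..1} (F z)"
proof (induction rule: z_polynomial.induct)
  case (cong F G)
  thus ?case using continuous_on_cong by metis
qed (auto intro!: continuous_intros)

lemma z_polynomial_holomorphic:
  "z_polynomial F \<Longrightarrow> x \<in> {0..1} \<Longrightarrow> (\<lambda>z. F z x) holomorphic_on UNIV"
proof (induction rule: z_polynomial.induct)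
  case (cong F G)
  hence "(\<lambda>z. G z x) = (\<lambda>z. F z x)" by auto
  with cong show ?case by simp
qed (auto intro!: holomorphic_intros)

lemma z_polynomial_mult:
  "z_polynomial F \<Longrightarrow> continuous_on {0..1} g \<Longrightarrow> z_polynomial (\<lambda>z x. g x * F z x)"
proof (induction rule: z_polynomial.induct)
  case (const h)
  thus ?case by (intro z_polynomial.const continuous_intros)
next
  case (add F G)
  thus ?case using z_polynomial.add by (simp add: distrib_left)
next
  case (times_z F)
  thus ?case using z_polynomial.times_z by (simp add: mult.left_commute)
next
  case (cong F G)
  show ?case by (rule z_polynomial.cong[OF cong.IH[OF cong.prems]]) (simp add: cong.hyps)
qed

lemma z_polynomial_integral:
  "z_polynomial F \<Longrightarrow> z_polynomial (\<lambda>z x. integral {0..x} (F z))"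
proof (induction rule: z_polynomial.induct)
  case (const g)
  thus ?case by (intro z_polynomial.const indefinite_integral_continuous_1 integrable_continuous_real)
next
  case (add F G)
  show ?case
  proof (rule z_polynomial.cong[OF z_polynomial.add[OF add.IH]])
    fix z and x :: real assume "x \<in> {0..1}"
    thus "integral {0..x} (\<lambda>x. F z x + G z x) = integral {0..x} (F z) + integral {0..x} (G z)"
      using add.hyps
      by (intro integral_add integrable_continuous_real
           continuous_on_subset[OF z_polynomial_continuous]) auto
  qed
next
  case (times_z F)
  thus ?case using z_polynomial.times_z by simp
next
  case (cong F G)
  show ?case
    by (rule z_polynomial.cong[OF cong.IH]) (auto intro!: integral_cong cong.hyps)
qed

text \<open>The terms of the Picard series: \<open>y\<^sub>0 = c + d * x\<close> and \<open>y\<^sub>n\<^sub>+\<^sub>1'' = (q - z) * y\<^sub>n\<close> with zero data at 0.\<close>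
primrec picard :: "(real \<Rightarrow> real) \<Rightarrow> complex \<Rightarrow> complex \<Rightarrow> nat \<Rightarrow> complex \<Rightarrow> real \<Rightarrow> complex"
  where
  "picard q c d 0 z x = c + of_real x * d"
| "picard q c d (Suc n) z x =
     integral {0..x} (\<lambda>s. integral {0..s} (\<lambda>t. (of_real (q t) - z) * picard q c d n z t))"

primrec picard_deriv :: "(real \<Rightarrow> real) \<Rightarrow> complex \<Rightarrow> complex \<Rightarrow> nat \<Rightarrow> complex \<Rightarrow> real \<Rightarrow> complex"
  where
  "picard_deriv q c d 0 z x = d"
| "picard_deriv q c d (Suc n) z x =
     integral {0..x} (\<lambda>t. (of_real (q t) - z) * picard q c d n z t)"

lemma z_polynomial_potential:
  assumes "continuous_on {0..1} q" "z_polynomial F"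
  shows "z_polynomial (\<lambda>z x. (of_real (q x) - z) * F z x)"
proof -
  have "z_polynomial (\<lambda>z x. of_real (q x) * F z x + z * (-1 * F z x))"
    using assms by (intro z_polynomial.add z_polynomial.times_z z_polynomial_mult continuous_intros)
  thus ?thesis by (simp add: algebra_simps)
qed

lemma z_polynomial_picard:
  assumes "continuous_on {0..1} q"
  shows "z_polynomial (picard q c d n)" "z_polynomial (picard_deriv q c d n)"
proof -
  show *: "z_polynomial (picard q c d n)" for n
  proof (induction n)
    case 0
    have "z_polynomial (\<lambda>z x. c + of_real x * d)"
      by (intro z_polynomial.const continuous_intros)
    thus ?case by (rule z_polynomial.cong) simp
  next
    case (Suc n)
    have "z_polynomial (\<lambda>z x. integral {0..x} (\<lambda>s. integral {0..s}
            (\<lambda>t. (of_real (q t) - z) * picard q c d n z t)))"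
      by (intro z_polynomial_integral z_polynomial_potential assms Suc)
    thus ?case by (rule z_polynomial.cong) simp
  qed
  show "z_polynomial (picard_deriv q c d n)"
  proof (cases n)
    case 0
    have "z_polynomial (\<lambda>z x. d)" by (intro z_polynomial.const continuous_intros)
    thus ?thesis unfolding 0 by (rule z_polynomial.cong) simp
  next
    case (Suc m)
    have "z_polynomial (\<lambda>z x. integral {0..x} (\<lambda>t. (of_real (q t) - z) * picard q c d m z t))"
      by (intro z_polynomial_integral z_polynomial_potential assms *)
    thus ?thesis unfolding Suc by (rule z_polynomial.cong) simp
  qed
qed

text \<open>Termwise differentiation of a series on a compact interval, one-sided at the endpoints.\<close>
lemma has_vector_derivative_suminf:
  fixes f :: "nat \<Rightarrow> real \<Rightarrow> complex"
  assumes f: "\<And>n x. x \<in> {a..b} \<Longrightarrow> (f n has_vector_derivative f' n x) (at x within {a..b})"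
    and u: "uniform_limit {a..b} (\<lambda>N x. \<Sum>n<N. f' n x) g' sequentially"
    and s: "\<And>x. x \<in> {a..b} \<Longrightarrow> summable (\<lambda>n. f n x)"
    and x: "x \<in> {a..b}"
  shows "((\<lambda>x. \<Sum>n. f n x) has_vector_derivative g' x) (at x within {a..b})"
proof -
  have "\<exists>g. \<forall>x\<in>{a..b}. (\<lambda>n. f n x) sums (g x) \<and> (g has_derivative (\<lambda>h. h *\<^sub>R g' x)) (at x within {a..b})"
  proof (rule has_derivative_series[where f' = "\<lambda>n x h. h *\<^sub>R f' n x", OF _ _ _ x])
    fix e :: real assume "e > 0"
    from uniform_limitD[OF u this]
    show "\<forall>\<^sub>F n in sequentially. \<forall>x\<in>{a..b}. \<forall>h.
            norm ((\<Sum>i<n. h *\<^sub>R f' i x) - h *\<^sub>R g' x) \<le> e * norm h"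
    proof eventually_elim
      case (elim n)
      have "norm ((\<Sum>i<n. h *\<^sub>R f' i x) - h *\<^sub>R g' x) \<le> e * norm h" if "x \<in> {a..b}" for x h
      proof -
        have "norm ((\<Sum>i<n. h *\<^sub>R f' i x) - h *\<^sub>R g' x) = norm (h *\<^sub>R ((\<Sum>i<n. f' i x) - g' x))"
          by (simp only: scaleR_sum_right scaleR_diff_right)
        also have "\<dots> \<le> norm h * e"
          unfolding norm_scaleR real_norm_def using elim that
          by (intro mult_left_mono) (auto simp: dist_norm intro: less_imp_le)
        finally show ?thesis by (simp add: mult.commute)
      qed
      thus ?case by blast
    qed
  qed (use f s[OF x] in \<open>auto simp: has_vector_derivative_def\<close>)
  then obtain g where g: "\<And>x. x \<in> {a..b} \<Longrightarrow> (\<lambda>n. f n x) sums g x"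
    "\<And>x. x \<in> {a..b} \<Longrightarrow> (g has_vector_derivative g' x) (at x within {a..b})"
    unfolding has_vector_derivative_def by blast
  show ?thesis
    by (rule has_vector_derivative_transform[OF x _ g(2)[OF x]]) (use g(1) in \<open>auto simp: sums_iff\<close>)
qed

text \<open>
  In the weight \<open>exp (2 * K * x)\<close> every step of the iteration halves the bound, so the series converges
  geometrically, uniformly in \<open>x\<close> and in all \<open>z\<close> that share the same \<open>K\<close>.
\<close>
lemma picard_bounds:
  fixes c d :: complex
  assumes q: "continuous_on {0..1} q" and K: "K \<ge> 1" "\<And>t. t \<in> {0..1} \<Longrightarrow> norm (of_real (q t) - z) \<le> K"
    and x: "x \<in> {0..1}"
  defines "B \<equiv> norm c + norm d"
  shows "norm (picard q c d n z x) \<le> B * exp (2 * K) * (1 / 2) ^ n"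
    and "norm (picard_deriv q c d n z x) \<le> B * exp (2 * K) * (1 / 2) ^ n"
proof -
  have B: "B \<ge> 0" by (simp add: B_def)
  have weaken: "B * (1 / 2) ^ n * exp (2 * K * x) \<le> B * exp (2 * K) * (1 / 2) ^ n"
    if "x \<in> {0..1}" for x n
  proof -
    have "exp (2 * K * x) \<le> exp (2 * K)" using that K(1) by (simp add: mult_left_le)
    hence "B * (1 / 2) ^ n * exp (2 * K * x) \<le> B * (1 / 2) ^ n * exp (2 * K)"
      using B by (intro mult_left_mono) auto
    thus ?thesis by (simp add: mult.assoc mult.commute[of "exp _"])
  qed
  note contp = z_polynomial_continuous[OF z_polynomial_picard(1)[OF q]]
    and contd = z_polynomial_continuous[OF z_polynomial_picard(2)[OF q]]
  have step: "norm (picard_deriv q c d (Suc n) z x) \<le> B * (1 / 2) ^ Suc n * exp (2 * K * x)"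
    if *: "\<And>x. x \<in> {0..1} \<Longrightarrow> norm (picard q c d n z x) \<le> B * (1 / 2) ^ n * exp (2 * K * x)"
      and x: "x \<in> {0..1}" for n x
  proof -
    have "norm (integral {0..x} (\<lambda>t. (of_real (q t) - z) * picard q c d n z t))
            \<le> (K * (B * (1 / 2) ^ n)) / (2 * K) * exp (2 * K * x)"
    proof (intro integral_exp_bound x)
      show "norm ((of_real (q t) - z) * picard q c d n z t) \<le> K * (B * (1 / 2) ^ n) * exp (2 * K * t)"
        if "t \<in> {0..1}" for t
        using mult_mono[OF K(2)[OF that] *[OF that]] K(1) by (simp add: norm_mult mult.assoc)
    qed (use K(1) in \<open>auto intro!: continuous_intros q contp\<close>)
    thus ?thesis using K(1) by simp
  qed
  have *: "norm (picard q c d n z x) \<le> B * (1 / 2) ^ n * exp (2 * K * x)" if "x \<in> {0..1}" for n x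
    using that
  proof (induction n arbitrary: x)
    case 0
    have "norm (c + of_real x * d) \<le> norm c + norm (of_real x * d)" by (rule norm_triangle_ineq)
    also have "\<dots> \<le> norm c + 1 * norm d"
      using 0 unfolding norm_mult by (intro add_left_mono mult_right_mono) auto
    also have "\<dots> = B * 1" by (simp add: B_def)
    also have "\<dots> \<le> B * exp (2 * K * x)" using 0 K(1) B by (intro mult_left_mono) auto
    finally show ?case by simp
  next
    case (Suc n)
    have eq: "picard q c d (Suc n) z x = integral {0..x} (picard_deriv q c d (Suc n) z)"
      by (simp cong: integral_cong)
    have "norm (integral {0..x} (picard_deriv q c d (Suc n) z))
            \<le> (B * (1 / 2) ^ Suc n) / (2 * K) * exp (2 * K * x)"
      using K(1) Suc by (intro integral_exp_bound step contd) auto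
    also have "\<dots> \<le> B * (1 / 2) ^ Suc n / 1 * exp (2 * K * x)"
      using K(1) B by (intro mult_right_mono divide_left_mono) auto
    finally show ?case unfolding eq by simp
  qed
  show "norm (picard q c d n z x) \<le> B * exp (2 * K) * (1 / 2) ^ n"
    using *[OF x] weaken[OF x] by (rule order_trans)
  have "norm (picard_deriv q c d n z x) \<le> B * (1 / 2) ^ n * exp (2 * K * x)"
  proof (cases n)
    case 0
    have "norm d * 1 \<le> B * exp (2 * K * x)" using x K(1) by (intro mult_mono) (auto simp: B_def)
    thus ?thesis by (simp add: 0)
  next
    case (Suc m)
    show ?thesis unfolding Suc by (intro step * x)
  qed
  thus "norm (picard_deriv q c d n z x) \<le> B * exp (2 * K) * (1 / 2) ^ n"
    using weaken[OF x] by (rule order_trans)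
qed

lemma potential_bound:
  fixes q :: "real \<Rightarrow> real"
  assumes q: "continuous_on {0..1} q"
  obtains K where "K \<ge> 1" "\<And>t z. t \<in> {0..1} \<Longrightarrow> norm z \<le> R \<Longrightarrow> norm (complex_of_real (q t) - z) \<le> K"
proof -
  have "compact (q ` {0..1})" by (intro compact_continuous_image q) simp
  then obtain M where M: "\<And>t. t \<in> {0..1} \<Longrightarrow> \<bar>q t\<bar> \<le> M"
    by (metis compact_imp_bounded bounded_iff image_eqI real_norm_def)
  show ?thesis
  proof (rule that[of "max 1 (M + R)"])
    fix t :: real and z :: complex assume "t \<in> {0..1}" "norm z \<le> R"
    thus "norm (complex_of_real (q t) - z) \<le> max 1 (M + R)"
      using M[of t] norm_triangle_ineq4[of "complex_of_real (q t)" z] by simp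
  qed simp
qed

text \<open>The convergence is locally uniform in \<open>z\<close>, and limits of polynomials in \<open>z\<close> are then holomorphic.\<close>
lemma holomorphic_picard_sum:
  assumes q: "continuous_on {0..1} q" and x: "x \<in> {0..1}"
  shows "(\<lambda>z. \<Sum>n. picard q c d n z x) holomorphic_on UNIV"
    and "(\<lambda>z. \<Sum>n. picard_deriv q c d n z x) holomorphic_on UNIV"
proof -
  have ul: "uniform_limit (cball z 1) (\<lambda>N z. \<Sum>n<N. F n z) (\<lambda>z. \<Sum>n. F n z) sequentially"
    if F: "\<And>K n z. K \<ge> 1 \<Longrightarrow> (\<And>t. t \<in> {0..1} \<Longrightarrow> norm (of_real (q t) - z) \<le> K) \<Longrightarrow>
             norm (F n z) \<le> (norm c + norm d) * exp (2 * K) * (1 / 2) ^ n"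
    for F :: "nat \<Rightarrow> complex \<Rightarrow> complex" and z
  proof -
    obtain K where K: "K \<ge> 1"
      "\<And>t w. t \<in> {0..1} \<Longrightarrow> norm w \<le> norm z + 1 \<Longrightarrow> norm (complex_of_real (q t) - w) \<le> K"
      using potential_bound[OF q] by metis
    show ?thesis
    proof (rule Weierstrass_m_test)
      fix n w assume "w \<in> cball z 1"
      hence "norm w \<le> norm z + 1"
        using norm_triangle_ineq2[of w z] by (simp add: dist_norm norm_minus_commute)
      thus "norm (F n w) \<le> (norm c + norm d) * exp (2 * K) * (1 / 2) ^ n" by (intro F K)
    qed (auto intro!: summable_mult summable_geometric)
  qed
  show "(\<lambda>z. \<Sum>n. picard q c d n z x) holomorphic_on UNIV"
    by (rule holomorphic_uniform_sequence[where f = "\<lambda>N z. \<Sum>n<N. picard q c d n z x"])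
       (auto intro!: holomorphic_intros z_polynomial_holomorphic z_polynomial_picard q exI[of _ 1]
          ul picard_bounds(1) simp: x[simplified])
  show "(\<lambda>z. \<Sum>n. picard_deriv q c d n z x) holomorphic_on UNIV"
    by (rule holomorphic_uniform_sequence[where f = "\<lambda>N z. \<Sum>n<N. picard_deriv q c d n z x"])
       (auto intro!: holomorphic_intros z_polynomial_holomorphic z_polynomial_picard q exI[of _ 1]
          ul picard_bounds(2) simp: x[simplified])
qed

lemma solves_picard_sum:
  assumes q: "continuous_on {0..1} q"
  shows "solves q z (\<lambda>x. \<Sum>n. picard q c d n z x)"
    and "\<And>x. x \<in> {0..1} \<Longrightarrow>
           deriv01 (\<lambda>x. \<Sum>n. picard q c d n z x) x = (\<Sum>n. picard_deriv q c d n z x)"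
    and "(\<Sum>n. picard q c d n z 0) = c" and "(\<Sum>n. picard_deriv q c d n z 0) = d"
proof -
  obtain K where K: "K \<ge> 1" "\<And>t. t \<in> {0..1} \<Longrightarrow> norm (complex_of_real (q t) - z) \<le> K"
    using potential_bound[OF q, of "norm z"] by (metis order_refl)
  define B where "B = (norm c + norm d) * exp (2 * K)"
  note b = picard_bounds[OF q K, of _ c d, folded B_def]
  have sB: "summable (\<lambda>n. B * (1 / 2) ^ n)" by (auto intro!: summable_mult summable_geometric)
  have sp: "summable (\<lambda>n. picard q c d n z x)" if "x \<in> {0..1}" for x
    using b(1)[OF _ that] by (intro summable_comparison_test'[OF sB]) auto
  have sd: "summable (\<lambda>n. picard_deriv q c d n z x)" if "x \<in> {0..1}" for x
    using b(2)[OF _ that] by (intro summable_comparison_test'[OF sB]) auto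
  \<comment> \<open>The termwise second derivatives; the index shift comes from \<open>y\<^sub>0'' = 0\<close>.\<close>
  define W where "W = (\<lambda>n x. case n of 0 \<Rightarrow> 0 | Suc m \<Rightarrow> (of_real (q x) - z) * picard q c d m z x)"
  note contp = z_polynomial_continuous[OF z_polynomial_picard(1)[OF q]]
    and contd = z_polynomial_continuous[OF z_polynomial_picard(2)[OF q]]
  have dp: "(picard q c d n z has_vector_derivative picard_deriv q c d n z x) (at x within {0..1})"
    if "x \<in> {0..1}" for n x
  proof (cases n)
    case 0
    have "((\<lambda>x. c + of_real x * d) has_vector_derivative d) (at x within {0..1})"
      by (auto intro!: derivative_eq_intros simp: has_vector_derivative_def scaleR_conv_of_real)
    moreover have "picard q c d 0 z = (\<lambda>x. c + of_real x * d)" by auto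
    ultimately show ?thesis by (simp add: 0)
  next
    case (Suc m)
    have "((\<lambda>x. integral {0..x} (picard_deriv q c d n z)) has_vector_derivative picard_deriv q c d n z x)
           (at x within {0..1})" by (intro integral_has_vector_derivative contd that)
    moreover have "picard q c d n z = (\<lambda>x. integral {0..x} (picard_deriv q c d n z))"
      by (auto simp: Suc cong: integral_cong)
    ultimately show ?thesis by simp
  qed
  have dd: "(picard_deriv q c d n z has_vector_derivative W n x) (at x within {0..1})"
    if "x \<in> {0..1}" for n x
  proof (cases n)
    case (Suc m)
    have "((\<lambda>x. integral {0..x} (\<lambda>t. (of_real (q t) - z) * picard q c d m z t)) has_vector_derivative
            (of_real (q x) - z) * picard q c d m z x) (at x within {0..1})"
      by (intro integral_has_vector_derivative that continuous_intros contp q)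
    moreover have "picard_deriv q c d n z =
        (\<lambda>x. integral {0..x} (\<lambda>t. (of_real (q t) - z) * picard q c d m z t))"
      by (auto simp: Suc)
    ultimately show ?thesis by (simp add: Suc W_def)
  next
    case 0
    have "picard_deriv q c d n z = (\<lambda>x. d)" by (auto simp: 0)
    thus ?thesis by (simp add: 0 W_def)
  qed
  have bW: "norm (W n x) \<le> 2 * K * B * (1 / 2) ^ n" if "x \<in> {0..1}" for n x
  proof (cases n)
    case 0
    thus ?thesis using K(1) by (simp add: W_def B_def)
  next
    case (Suc m)
    have "norm (W n x) \<le> K * (B * (1 / 2) ^ m)"
      unfolding W_def Suc using mult_mono[OF K(2)[OF that] b(1)[OF _ that]] K(1) by (simp add: norm_mult)
    thus ?thesis by (simp add: Suc)
  qed
  have W_sum: "(\<Sum>n. W n x) = (of_real (q x) - z) * (\<Sum>n. picard q c d n z x)" if "x \<in> {0..1}" for x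
  proof -
    have "(\<lambda>n. W (Suc n) x) sums ((of_real (q x) - z) * (\<Sum>n. picard q c d n z x))"
      unfolding W_def using sp[OF that] by (simp add: sums_mult summable_sums)
    hence "(\<lambda>n. W n x) sums ((of_real (q x) - z) * (\<Sum>n. picard q c d n z x) + W 0 x)"
      by (rule sums_Suc)
    thus ?thesis by (simp add: sums_iff W_def)
  qed
  have D1: "((\<lambda>x. \<Sum>n. picard q c d n z x) has_vector_derivative (\<Sum>n. picard_deriv q c d n z x))
         (at x within {0..1})" if "x \<in> {0..1}" for x
    by (rule has_vector_derivative_suminf[OF dp Weierstrass_m_test sp that]) (use b(2) sB in auto)
  have D2: "((\<lambda>x. \<Sum>n. picard_deriv q c d n z x) has_vector_derivative
         (of_real (q x) - z) * (\<Sum>n. picard q c d n z x)) (at x within {0..1})" if "x \<in> {0..1}" for x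
    unfolding W_sum[OF that, symmetric]
    by (rule has_vector_derivative_suminf[OF dd Weierstrass_m_test sd that, OF _ bW])
       (auto intro!: summable_mult summable_geometric)
  show "solves q z (\<lambda>x. \<Sum>n. picard q c d n z x)"
    and "\<And>x. x \<in> {0..1} \<Longrightarrow>
           deriv01 (\<lambda>x. \<Sum>n. picard q c d n z x) x = (\<Sum>n. picard_deriv q c d n z x)"
    using solvesI[OF D1 D2] by auto
  have "(\<lambda>n. picard q c d n z 0) sums (\<Sum>n\<in>{0}. picard q c d n z 0)"
    by (rule sums_finite) (auto simp: gr0_conv_Suc)
  moreover have "(\<lambda>n. picard_deriv q c d n z 0) sums (\<Sum>n\<in>{0}. picard_deriv q c d n z 0)"
    by (rule sums_finite) (auto simp: gr0_conv_Suc)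
  ultimately show "(\<Sum>n. picard q c d n z 0) = c" "(\<Sum>n. picard_deriv q c d n z 0) = d"
    by (simp_all add: sums_iff)
qed

text \<open>The Picard series shows that the choice in \<open>ivp_solution\<close> is from a nonempty set.\<close>
lemma ivp_solution:
  assumes "continuous_on {0..1} q"
  shows "solves q z (ivp_solution q z c d)"
    and "ivp_solution q z c d 0 = c" and "deriv01 (ivp_solution q z c d) 0 = d"
proof -
  have "\<exists>y. solves q z y \<and> y 0 = c \<and> deriv01 y 0 = d"
    using solves_picard_sum[OF assms, where z = z and c = c and d = d]
    by (intro exI[of _ "\<lambda>x. \<Sum>n. picard q c d n z x"]) auto
  from someI_ex[OF this]
  show "solves q z (ivp_solution q z c d)"
    and "ivp_solution q z c d 0 = c" and "deriv01 (ivp_solution q z c d) 0 = d"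
    by (simp_all add: ivp_solution_def)
qed

lemma ivp_solution_holomorphic:
  assumes q: "continuous_on {0..1} q" and x: "x \<in> {0..1}"
  shows "(\<lambda>z. ivp_solution q z c d x) holomorphic_on UNIV"
    and "(\<lambda>z. deriv01 (ivp_solution q z c d) x) holomorphic_on UNIV"
proof -
  have *: "ivp_solution q z c d x = (\<Sum>n. picard q c d n z x)"
    "deriv01 (ivp_solution q z c d) x = (\<Sum>n. picard_deriv q c d n z x)" for z
    using solves_unique[OF q ivp_solution(1)[OF q, of z c d] solves_picard_sum(1)[OF q, where z = z and c = c and d = d] _ _ x]
      solves_picard_sum[OF q, where z = z and c = c and d = d] x by (simp_all add: ivp_solution[OF q])
  show "(\<lambda>z. ivp_solution q z c d x) holomorphic_on UNIV"
    and "(\<lambda>z. deriv01 (ivp_solution q z c d) x) holomorphic_on UNIV"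
    unfolding * by (rule holomorphic_picard_sum[OF q x])+
qed

section \<open>Asymptotics for large spectral parameter\<close>

text \<open>
  The operator \<open>u'' - \<mu>\<^sup>2 u\<close> factors: \<open>w = u' + \<mu> u\<close> satisfies \<open>w' = \<mu> w + f\<close>, hence
  \<open>exp (\<mu> * (x - t)) * w t\<close> has derivative \<open>exp (\<mu> * (x - t)) * f t\<close>. If \<open>f\<close> grows at most like
  \<open>exp (\<tau> * t)\<close> with \<open>\<tau> \<ge> \<bar>Re \<mu>\<bar>\<close>, this derivative is bounded by a constant and the mean value inequality
  suffices.
\<close>
lemma first_order_bound:
  fixes u u' f :: "real \<Rightarrow> complex"
  assumes u: "\<And>t. t \<in> {0..1} \<Longrightarrow> (u has_vector_derivative u' t) (at t within {0..1})"
    and u': "\<And>t. t \<in> {0..1} \<Longrightarrow> (u' has_vector_derivative \<mu>\<^sup>2 * u t + f t) (at t within {0..1})"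
    and f: "\<And>t. t \<in> {0..1} \<Longrightarrow> norm (f t) \<le> B * exp (\<tau> * t)"
    and \<mu>: "\<bar>Re \<mu>\<bar> \<le> \<tau>" and x: "x \<in> {0..1}"
  shows "norm (u' x + \<mu> * u x) \<le> (norm (u' 0 + \<mu> * u 0) + B) * exp (\<tau> * x)"
proof -
  have B: "B \<ge> 0" using order_trans[OF norm_ge_zero f[of 0]] by simp
  define e where "e = (\<lambda>t. exp (\<mu> * of_real (x - t)))"
  define g where "g = (\<lambda>t. e t * (u' t + \<mu> * u t))"
  have e: "norm (e t) \<le> exp (\<tau> * (x - t))" if "t \<le> x" for t
  proof -
    have "Re \<mu> * (x - t) \<le> \<tau> * (x - t)" using that \<mu> by (intro mult_right_mono) auto
    thus ?thesis by (simp add: e_def norm_exp_eq_Re)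
  qed
  have g': "(g has_vector_derivative e t * f t) (at t within {0..x})" if "t \<in> {0..x}" for t
  proof -
    have t: "t \<in> {0..1}" using that x by auto
    have sub: "{0..x} \<subseteq> {0..1}" using x by auto
    have "((\<lambda>t. \<mu> * of_real (x - t)) has_vector_derivative - \<mu>) (at t within {0..1})"
      by (auto intro!: derivative_eq_intros simp: has_vector_derivative_def scaleR_conv_of_real)
    hence de: "(e has_vector_derivative - \<mu> * e t) (at t within {0..1})"
      using field_vector_diff_chain_within[OF _ has_field_derivative_at_within[OF DERIV_exp]]
      by (fastforce simp: o_def e_def)
    have "(g has_vector_derivative (e t * (\<mu>\<^sup>2 * u t + f t + \<mu> * u' t) + - \<mu> * e t * (u' t + \<mu> * u t)))
            (at t within {0..1})"
      unfolding g_def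
      by (intro has_vector_derivative_mult de has_vector_derivative_add has_vector_derivative_mult_right
            u u' t)
    also have "e t * (\<mu>\<^sup>2 * u t + f t + \<mu> * u' t) + - \<mu> * e t * (u' t + \<mu> * u t) = e t * f t"
      by (simp add: algebra_simps power2_eq_square)
    finally show ?thesis by (rule has_vector_derivative_within_subset[OF _ sub])
  qed
  have "norm (g x - g 0) \<le> B * exp (\<tau> * x) * norm (x - 0)"
  proof (rule differentiable_bound[where S = "{0..x}" and f' = "\<lambda>t h. h *\<^sub>R (e t * f t)"])
    fix t assume t: "t \<in> {0..x}"
    have "norm (e t * f t) \<le> exp (\<tau> * (x - t)) * (B * exp (\<tau> * t))"
      unfolding norm_mult using t x by (intro mult_mono e f) auto
    also have "\<dots> = B * exp (\<tau> * x)" by (simp add: exp_add[symmetric] algebra_simps)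
    finally have b: "norm (e t * f t) \<le> B * exp (\<tau> * x)" .
    show "onorm (\<lambda>h. h *\<^sub>R (e t * f t)) \<le> B * exp (\<tau> * x)"
    proof (rule onorm_le)
      fix h :: real
      show "norm (h *\<^sub>R (e t * f t)) \<le> B * exp (\<tau> * x) * norm h"
        using mult_right_mono[OF b, of "norm h"] by (simp add: mult.commute)
    qed
    show "(g has_derivative (\<lambda>h. h *\<^sub>R (e t * f t))) (at t within {0..x})"
      using g'[OF t] by (simp add: has_vector_derivative_def)
  qed (use x in auto)
  also have "\<dots> \<le> B * exp (\<tau> * x) * 1" using x B by (intro mult_left_mono) auto
  finally have "norm (g x) \<le> norm (g 0) + B * exp (\<tau> * x)"
    using norm_triangle_ineq2[of "g x" "g 0"] by simp
  also have "norm (g 0) \<le> exp (\<tau> * x) * norm (u' 0 + \<mu> * u 0)"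
    unfolding g_def norm_mult using e[of 0] x by (intro mult_right_mono) auto
  also have "norm (g x) = norm (u' x + \<mu> * u x)" by (simp add: g_def e_def)
  finally show ?thesis by (simp add: algebra_simps)
qed

lemma norm_cos_sin_of_real_mult_le:
  assumes "x \<ge> 0"
  shows "norm (cos (of_real x * \<rho>)) \<le> exp (x * \<bar>Im \<rho>\<bar>)"
    and "norm (sin (of_real x * \<rho>)) \<le> exp (x * \<bar>Im \<rho>\<bar>)"
  using cmod_cos_le_exp[of 1 "of_real x * \<rho>"] cmod_sin_le_exp[of 1 "of_real x * \<rho>"] assms
  by (simp_all add: abs_mult)

text \<open>
  Apply \<open>first_order_bound\<close> with \<open>\<mu> = \<i> * \<rho>\<close> and \<open>\<mu> = - \<i> * \<rho>\<close> to \<open>u = y - y 0 * cos (\<rho> t)\<close>, which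
  satisfies \<open>u'' + \<rho>\<^sup>2 u = q y\<close>. The two resulting functions \<open>u' \<plusminus> \<i> * \<rho> * u\<close> give \<open>u'\<close> as half their sum
  and \<open>\<rho> * u\<close> as half their difference up to a unit factor, which gains the \<open>1 / \<rho>\<close>. The right-hand
  side contains \<open>y\<close> itself, through \<open>S = sup \<bar>y t\<bar> * exp (- \<bar>Im \<rho>\<bar> * t)\<close>; for \<open>\<bar>\<rho>\<bar> \<ge> 2 * M\<close> the estimate
  bounds \<open>S\<close> by data plus \<open>S / 2\<close>, and \<open>S\<close> can be absorbed.
\<close>
lemma solves_estimate:
  assumes q: "\<And>x. x \<in> {0..1} \<Longrightarrow> \<bar>q x\<bar> \<le> M" and y: "solves q (\<rho>\<^sup>2) y"
    and \<rho>: "norm \<rho> \<ge> 1" "norm \<rho> \<ge> 2 * M" and x: "x \<in> {0..1}"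
  defines "A \<equiv> norm (deriv01 y 0) + 2 * M * (norm (y 0) + norm (deriv01 y 0))"
  shows "norm (y x - y 0 * cos (of_real x * \<rho>)) \<le> A * exp (x * \<bar>Im \<rho>\<bar>) / norm \<rho>"
    and "norm (deriv01 y x + y 0 * \<rho> * sin (of_real x * \<rho>)) \<le> A * exp (x * \<bar>Im \<rho>\<bar>)"
proof -
  define \<tau> where "\<tau> = \<bar>Im \<rho>\<bar>"
  define c where "c = y 0"
  define d where "d = deriv01 y 0"
  define u where "u = (\<lambda>t. y t - c * cos (of_real t * \<rho>))"
  define u' where "u' = (\<lambda>t. deriv01 y t + c * \<rho> * sin (of_real t * \<rho>))"
  note dy = solves_derivs[OF y]
  have M: "M \<ge> 0" using q[of 0] by auto
  have arg: "((\<lambda>t. of_real t * \<rho>) has_vector_derivative \<rho>) (at t within {0..1})" for t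
    by (auto intro!: derivative_eq_intros simp: has_vector_derivative_def scaleR_conv_of_real)
  have dcos: "((\<lambda>t. cos (of_real t * \<rho>)) has_vector_derivative - \<rho> * sin (of_real t * \<rho>)) (at t within {0..1})"
    and dsin: "((\<lambda>t. sin (of_real t * \<rho>)) has_vector_derivative \<rho> * cos (of_real t * \<rho>)) (at t within {0..1})"
    for t
    using field_vector_diff_chain_within[OF arg has_field_derivative_at_within[OF DERIV_cos]]
          field_vector_diff_chain_within[OF arg has_field_derivative_at_within[OF DERIV_sin]]
    by (simp_all add: o_def)
  have du: "(u has_vector_derivative u' t) (at t within {0..1})" if "t \<in> {0..1}" for t
    using has_vector_derivative_diff[OF dy(1)[OF that] has_vector_derivative_mult_right[OF dcos, of c]]
    unfolding u_def u'_def by (simp add: algebra_simps)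
  have du': "(u' has_vector_derivative \<mu>\<^sup>2 * u t + of_real (q t) * y t) (at t within {0..1})"
    if "t \<in> {0..1}" "\<mu>\<^sup>2 = - \<rho>\<^sup>2" for t \<mu>
    using has_vector_derivative_add[OF dy(2)[OF that(1)] has_vector_derivative_mult_right[OF dsin, of "c * \<rho>"]]
    unfolding u_def u'_def that(2) by (simp add: algebra_simps power2_eq_square)
  let ?n = "\<lambda>t. norm (y t) * exp (- (\<tau> * t))"
  have "continuous_on {0..1} ?n" by (intro continuous_intros solves_continuous[OF y])
  then obtain s where s: "s \<in> {0..1}" "\<And>t. t \<in> {0..1} \<Longrightarrow> ?n t \<le> ?n s"
    using continuous_attains_sup[of "{0..1::real}" ?n] by auto
  define S where "S = ?n s"
  have S0: "S \<ge> 0" by (simp add: S_def)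
  have bd: "norm (y t) \<le> S * exp (\<tau> * t)" if "t \<in> {0..1}" for t
  proof -
    have "norm (y t) = ?n t * exp (\<tau> * t)" by (simp add: mult.assoc flip: exp_add)
    also have "\<dots> \<le> S * exp (\<tau> * t)"
      using s(2)[OF that] unfolding S_def by (intro mult_right_mono) auto
    finally show ?thesis .
  qed
  have f: "norm (of_real (q t) * y t) \<le> M * S * exp (\<tau> * t)" if "t \<in> {0..1}" for t
    using mult_mono[OF q[OF that] bd[OF that] M norm_ge_zero] by (simp add: norm_mult mult.assoc)
  have u0: "u 0 = 0" "u' 0 = d" by (simp_all add: u_def u'_def c_def d_def)
  have w1: "norm (u' t + \<i> * \<rho> * u t) \<le> (norm d + M * S) * exp (\<tau> * t)" if "t \<in> {0..1}" for t
    using first_order_bound[OF du du' f _ that, of "\<i> * \<rho>"]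
    by (simp add: u0 power_mult_distrib \<tau>_def)
  have w2: "norm (u' t + - \<i> * \<rho> * u t) \<le> (norm d + M * S) * exp (\<tau> * t)" if "t \<in> {0..1}" for t
    using first_order_bound[OF du du' f _ that, of "- \<i> * \<rho>"]
    by (simp add: u0 power_mult_distrib \<tau>_def)
  have bu: "norm \<rho> * norm (u t) \<le> (norm d + M * S) * exp (\<tau> * t)" if "t \<in> {0..1}" for t
  proof -
    have "norm \<rho> * norm (u t) * 2 = norm ((u' t + \<i> * \<rho> * u t) - (u' t + - \<i> * \<rho> * u t))"
      by (simp add: norm_mult)
    also have "\<dots> \<le> (norm d + M * S) * exp (\<tau> * t) + (norm d + M * S) * exp (\<tau> * t)"
      by (rule order_trans[OF norm_triangle_ineq4 add_mono[OF w1[OF that] w2[OF that]]])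
    finally show ?thesis by linarith
  qed
  have bu': "norm (u' t) \<le> (norm d + M * S) * exp (\<tau> * t)" if "t \<in> {0..1}" for t
  proof -
    have "norm (u' t) * 2 = norm ((u' t + \<i> * \<rho> * u t) + (u' t + - \<i> * \<rho> * u t))"
      by (simp flip: mult_2)
    also have "\<dots> \<le> (norm d + M * S) * exp (\<tau> * t) + (norm d + M * S) * exp (\<tau> * t)"
      by (rule order_trans[OF norm_triangle_ineq add_mono[OF w1[OF that] w2[OF that]]])
    finally show ?thesis by linarith
  qed
  have bu2: "norm (u t) \<le> (norm d + M * S) * exp (\<tau> * t) / norm \<rho>" if "t \<in> {0..1}" for t
  proof -
    have "norm \<rho> > 0" using \<rho>(1) by linarith
    thus ?thesis using bu[OF that] by (simp add: pos_le_divide_eq mult.commute)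
  qed
  have "S \<le> 2 * (norm c + norm d)"
  proof -
    have "norm (y s) = norm (c * cos (of_real s * \<rho>) + u s)" by (simp add: u_def)
    also have "\<dots> \<le> norm c * exp (\<tau> * s) + (norm d + M * S) * exp (\<tau> * s) / norm \<rho>"
      using s(1) norm_cos_sin_of_real_mult_le(1)[of s \<rho>]
      by (intro order_trans[OF norm_triangle_ineq] add_mono bu2)
         (auto simp: norm_mult \<tau>_def mult.commute intro!: mult_left_mono)
    also have "\<dots> = (norm c + (norm d + M * S) / norm \<rho>) * exp (\<tau> * s)" by (simp add: algebra_simps)
    also have "(norm d + M * S) / norm \<rho> \<le> norm d + S / 2"
    proof -
      have "norm d \<le> norm d * norm \<rho>" using \<rho>(1) by (simp add: mult_le_cancel_left1)
      moreover have "M * S \<le> norm \<rho> / 2 * S" using \<rho>(2) S0 by (intro mult_right_mono) auto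
      ultimately have "norm d + M * S \<le> (norm d + S / 2) * norm \<rho>" by (simp add: algebra_simps)
      thus ?thesis using \<rho>(1) by (subst pos_divide_le_eq) auto
    qed
    finally have "norm (y s) \<le> (norm c + (norm d + S / 2)) * exp (\<tau> * s)" by simp
    hence "S \<le> (norm c + (norm d + S / 2)) * exp (\<tau> * s) * exp (- (\<tau> * s))"
      unfolding S_def by (intro mult_right_mono) auto
    also have "\<dots> = norm c + (norm d + S / 2)" by (simp add: exp_minus)
    finally show ?thesis by simp
  qed
  hence "M * S \<le> M * (2 * (norm c + norm d))" using M by (intro mult_left_mono)
  hence A: "norm d + M * S \<le> A" by (simp add: A_def c_def d_def algebra_simps)
  have A': "(norm d + M * S) * exp (\<tau> * x) \<le> A * exp (x * \<bar>Im \<rho>\<bar>)"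
    using mult_right_mono[OF A, of "exp (\<tau> * x)"] by (simp add: \<tau>_def mult.commute)
  show "norm (y x - y 0 * cos (of_real x * \<rho>)) \<le> A * exp (x * \<bar>Im \<rho>\<bar>) / norm \<rho>"
    using order_trans[OF bu2[OF x] divide_right_mono[OF A', of "norm \<rho>"]]
    by (simp add: u_def c_def)
  show "norm (deriv01 y x + y 0 * \<rho> * sin (of_real x * \<rho>)) \<le> A * exp (x * \<bar>Im \<rho>\<bar>)"
    using order_trans[OF bu'[OF x] A'] by (simp add: u'_def c_def)
qed

text \<open>
  The natural size at \<open>x\<close> of solutions with data at 0. It is complex-valued so that it can serve as the
  comparison function of a Landau symbol for complex functions.
\<close>
definition growth :: "real \<Rightarrow> complex \<Rightarrow> complex" where
  "growth x \<rho> = of_real (exp (x * \<bar>Im \<rho>\<bar>))"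

lemma norm_growth: "norm (growth x \<rho>) = exp (x * \<bar>Im \<rho>\<bar>)"
  by (simp add: growth_def)

lemma growth_mult: "growth x \<rho> * growth y \<rho> = growth (x + y) \<rho>"
  by (simp add: growth_def distrib_right exp_add)

lemma cos_growth: "x \<ge> 0 \<Longrightarrow> (\<lambda>\<rho>. cos (of_real x * \<rho>)) \<in> O[F](growth x)"
  and sin_growth: "x \<ge> 0 \<Longrightarrow> (\<lambda>\<rho>. sin (of_real x * \<rho>)) \<in> O[F](growth x)"
  using norm_cos_sin_of_real_mult_le by (auto intro!: bigoI[where c = 1] simp: norm_growth)

lemma solution_asymptotics:
  fixes y :: "complex \<Rightarrow> real \<Rightarrow> complex"
  assumes q: "continuous_on {0..1} q" and y: "\<And>z. solves q z (y z)"
    and 0: "\<And>z. y z 0 = c" "\<And>z. deriv01 (y z) 0 = d" and x: "x \<in> {0..1}"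
  shows "(\<lambda>\<rho>. y (\<rho>\<^sup>2) x - c * cos (of_real x * \<rho>)) \<in> O[at_infinity](\<lambda>\<rho>. growth x \<rho> / \<rho>)"
    and "(\<lambda>\<rho>. deriv01 (y (\<rho>\<^sup>2)) x + c * \<rho> * sin (of_real x * \<rho>)) \<in> O[at_infinity](growth x)"
proof -
  obtain M where M: "\<And>t. t \<in> {0..1} \<Longrightarrow> \<bar>q t\<bar> \<le> M"
    using potential_bound[OF q, of 0] by (metis diff_zero norm_of_real norm_zero order_refl)
  define A where "A = norm d + 2 * M * (norm c + norm d)"
  have ev: "eventually (\<lambda>\<rho>::complex. norm \<rho> \<ge> max 1 (2 * M)) at_infinity"
    unfolding eventually_at_infinity by blast
  show "(\<lambda>\<rho>. y (\<rho>\<^sup>2) x - c * cos (of_real x * \<rho>)) \<in> O[at_infinity](\<lambda>\<rho>. growth x \<rho> / \<rho>)"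
  proof (rule bigoI[where c = A], use ev in eventually_elim)
    case (elim \<rho>)
    thus ?case using solves_estimate(1)[OF M y _ _ x, of \<rho>]
      by (simp add: 0 A_def norm_growth norm_divide)
  qed
  show "(\<lambda>\<rho>. deriv01 (y (\<rho>\<^sup>2)) x + c * \<rho> * sin (of_real x * \<rho>)) \<in> O[at_infinity](growth x)"
  proof (rule bigoI[where c = A], use ev in eventually_elim)
    case (elim \<rho>)
    thus ?case using solves_estimate(2)[OF M y _ _ x, of \<rho>]
      by (simp add: 0 A_def norm_growth)
  qed
qed

lemma growth_divide_bigo: "f \<in> O[at_infinity](\<lambda>\<rho>. growth x \<rho> / \<rho>) \<Longrightarrow> f \<in> O[at_infinity](growth x)"
proof (erule landau_o.big_trans, rule bigoI[where c = 1])
  have "eventually (\<lambda>\<rho>::complex. norm \<rho> \<ge> 1) at_infinity"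
    unfolding eventually_at_infinity by blast
  thus "\<forall>\<^sub>F \<rho> in at_infinity. norm (growth x \<rho> / \<rho>) \<le> 1 * norm (growth x \<rho>)"
    by eventually_elim (simp add: norm_divide divide_le_eq mult_le_cancel_left1 norm_growth)
qed

text \<open>For real \<open>\<rho>\<close> there is no exponential growth, so an error term simply tends to 0.\<close>
lemma bigo_growth_real_tendsto_0:
  assumes "f \<in> O[at_infinity](\<lambda>\<rho>. growth x \<rho> / \<rho>)"
  shows "(\<lambda>n. f (of_nat n)) \<longlonglongrightarrow> 0"
proof -
  have "filterlim (\<lambda>n. of_nat n :: complex) at_infinity sequentially"
    by (rule tendsto_of_nat)
  from landau_o.big.compose[OF assms this]
  have "(\<lambda>n. f (of_nat n)) \<in> O(\<lambda>n. growth x (of_nat n) / of_nat n)" .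
  also have "(\<lambda>n. growth x (of_nat n) / of_nat n) = (\<lambda>n. 1 / of_nat n)"
    by (simp add: growth_def)
  finally obtain c where c: "eventually (\<lambda>n. norm (f (of_nat n)) \<le> c * norm (1 / of_nat n :: complex)) sequentially"
    by (auto elim: landau_o.bigE)
  have "(\<lambda>n. c * norm (1 / of_nat n :: complex)) \<longlonglongrightarrow> c * norm (0 :: complex)"
    by (intro tendsto_intros lim_1_over_n)
  thus ?thesis by (intro Lim_null_comparison[OF c]) simp
qed

section \<open>Entire functions comparable to the sine\<close>
lemma norm_sin_ge_sinh: "norm (sin \<rho>) \<ge> (exp \<bar>Im \<rho>\<bar> - exp (- \<bar>Im \<rho>\<bar>)) / 2"
proof -
  have "2 * norm (sin \<rho>) = norm (exp (\<i> * \<rho>) - exp (- (\<i> * \<rho>)))"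
    by (simp add: sin_exp_eq norm_divide norm_mult)
  moreover have "\<bar>exp (- Im \<rho>) - exp (Im \<rho>)\<bar> \<le> norm (exp (\<i> * \<rho>) - exp (- (\<i> * \<rho>)))"
    using norm_triangle_ineq3[of "exp (\<i> * \<rho>)" "exp (- (\<i> * \<rho>))"] by (simp add: norm_exp_eq_Re)
  ultimately show ?thesis by (cases "Im \<rho> \<ge> 0") auto
qed

text \<open>
  On the vertical sides \<open>\<bar>sin (Re \<rho>)\<bar> = 1\<close>, so \<open>\<bar>Re (sin \<rho>)\<bar> = cosh (Im \<rho>)\<close>; on the horizontal sides
  \<open>\<bar>sin \<rho>\<bar> \<ge> sinh \<bar>Im \<rho>\<bar>\<close>, and \<open>\<bar>Im \<rho>\<bar> \<ge> 1\<close> there.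
\<close>
lemma norm_sin_ge_on_square:
  fixes n :: nat
  defines "N \<equiv> pi * (real n + 1 / 2)"
  assumes "\<bar>Re \<rho>\<bar> = N \<or> \<bar>Im \<rho>\<bar> = N"
  shows "norm (sin \<rho>) \<ge> exp \<bar>Im \<rho>\<bar> / 4"
  using assms(2)
proof
  assume "\<bar>Re \<rho>\<bar> = N"
  have "sin N = sin (pi * real n + pi / 2)" by (simp add: N_def algebra_simps)
  also have "\<dots> = cos (real n * pi)" by (simp add: sin_add mult.commute)
  also have "\<dots> = (-1) ^ n" by (rule cos_npi)
  finally have "\<bar>sin N\<bar> = 1" by simp
  moreover have "\<bar>sin (Re \<rho>)\<bar> = \<bar>sin N\<bar>"
    unfolding \<open>\<bar>Re \<rho>\<bar> = N\<close>[symmetric] by (simp add: abs_if)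
  ultimately have "\<bar>Re (sin \<rho>)\<bar> = (exp (Im \<rho>) + exp (- Im \<rho>)) / 2"
    by (simp add: Re_sin abs_mult)
  moreover have "exp \<bar>Im \<rho>\<bar> \<le> exp (Im \<rho>) + exp (- Im \<rho>)"
    by (simp add: abs_if)
  moreover have "exp \<bar>Im \<rho>\<bar> / 4 \<le> exp \<bar>Im \<rho>\<bar> / 2" by simp
  ultimately have "exp \<bar>Im \<rho>\<bar> / 4 \<le> \<bar>Re (sin \<rho>)\<bar>" by simp
  thus ?thesis using abs_Re_le_cmod[of "sin \<rho>"] by (rule order_trans)
next
  assume Im: "\<bar>Im \<rho>\<bar> = N"
  have "N \<ge> 3 * (1 / 2)" unfolding N_def using pi_gt3 by (intro mult_mono) auto
  hence "N \<ge> 1" by simp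
  have "exp N \<ge> 2" using exp_ge_add_one_self[of N] \<open>N \<ge> 1\<close> by linarith
  moreover have "exp (- N) \<le> 1" using \<open>N \<ge> 1\<close> by simp
  moreover have "(exp N - exp (- N)) / 2 \<le> norm (sin \<rho>)"
    using norm_sin_ge_sinh[of \<rho>] unfolding Im .
  moreover have "b \<le> 1 \<Longrightarrow> 2 \<le> a \<Longrightarrow> (a - b) / 2 \<le> s \<Longrightarrow> a / 4 \<le> s" for a b s :: real
    by (simp add: field_simps)
  ultimately show ?thesis unfolding Im by blast
qed

text \<open>
  On the boundary of a large square \<open>\<bar>W (\<rho>\<^sup>2)\<bar>\<close> is at least a multiple of \<open>\<bar>\<rho>\<bar> * exp \<bar>Im \<rho>\<bar>\<close>, so
  \<open>F (\<rho>\<^sup>2) = O(1/\<rho>)\<close> there, and the maximum principle carries this bound to any fixed point inside.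
  The squares lie in the \<open>\<rho>\<close>-plane, where \<open>F (\<rho>\<^sup>2)\<close> is again entire.
\<close>
lemma entire_eq_0_by_sine_type_division:
  assumes F: "F holomorphic_on UNIV"
    and W: "(\<lambda>\<rho>. W (\<rho>\<^sup>2) - \<rho> * sin \<rho>) \<in> O[at_infinity](growth 1)"
    and FW: "(\<lambda>\<rho>. F (\<rho>\<^sup>2) * W (\<rho>\<^sup>2)) \<in> O[at_infinity](growth 1)"
  shows "F z = 0"
proof -
  from W obtain C1 where C1: "C1 > 0"
      "\<forall>\<^sub>F \<rho> in at_infinity. norm (W (\<rho>\<^sup>2) - \<rho> * sin \<rho>) \<le> C1 * norm (growth 1 \<rho>)"
    by (auto elim: landau_o.bigE)
  from FW obtain C2 where C2: "C2 > 0"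
      "\<forall>\<^sub>F \<rho> in at_infinity. norm (F (\<rho>\<^sup>2) * W (\<rho>\<^sup>2)) \<le> C2 * norm (growth 1 \<rho>)"
    by (auto elim: landau_o.bigE)
  obtain R where R: "\<And>\<rho>. norm \<rho> \<ge> R \<Longrightarrow> norm (W (\<rho>\<^sup>2) - \<rho> * sin \<rho>) \<le> C1 * exp \<bar>Im \<rho>\<bar> \<and>
                          norm (F (\<rho>\<^sup>2) * W (\<rho>\<^sup>2)) \<le> C2 * exp \<bar>Im \<rho>\<bar>"
    using eventually_conj[OF C1(2) C2(2)] by (auto simp: eventually_at_infinity norm_growth)
  define N where "N = (\<lambda>n::nat. pi * (real n + 1 / 2))"
  have N: "filterlim N at_top sequentially"
    unfolding N_def by real_asymp
  define w where "w = csqrt z"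
  have "\<forall>\<^sub>F n in sequentially. N n \<ge> max (max 1 R) (max (8 * C1) (norm w))"
    using N unfolding filterlim_at_top by blast
  hence bound: "\<forall>\<^sub>F n in sequentially. norm (F z) \<le> 8 * C2 / N n"
  proof eventually_elim
    case (elim n)
    hence n: "N n \<ge> 1" "N n \<ge> R" "N n \<ge> 8 * C1" "N n \<ge> norm w" by auto
    let ?S = "cbox (Complex (- N n) (- N n)) (Complex (N n) (N n))"
    have "norm (F (w\<^sup>2)) \<le> 8 * C2 / N n"
    proof (rule maximum_modulus_frontier[where S = ?S and f = "\<lambda>\<rho>. F (\<rho>\<^sup>2)" and \<xi> = w])
      have hol: "(\<lambda>\<rho>. F (\<rho>\<^sup>2)) holomorphic_on UNIV"
        using holomorphic_on_compose_gen[OF _ F, of "\<lambda>\<rho>. \<rho>\<^sup>2" UNIV]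
        by (simp add: o_def holomorphic_on_power)
      thus "(\<lambda>\<rho>. F (\<rho>\<^sup>2)) holomorphic_on interior ?S" "continuous_on (closure ?S) (\<lambda>\<rho>. F (\<rho>\<^sup>2))"
        by (auto intro: holomorphic_on_subset holomorphic_on_imp_continuous_on)
      show "w \<in> ?S"
        using n(4) abs_Re_le_cmod[of w] abs_Im_le_cmod[of w] by (auto simp: in_cbox_complex_iff)
    next
      fix \<rho> assume "\<rho> \<in> frontier ?S"
      hence or: "\<bar>Re \<rho>\<bar> = N n \<or> \<bar>Im \<rho>\<bar> = N n"
        by (auto simp: frontier_cbox in_cbox_complex_iff in_box_complex_iff)
      hence \<rho>: "norm \<rho> \<ge> N n" using abs_Re_le_cmod[of \<rho>] abs_Im_le_cmod[of \<rho>] by auto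
      define E where "E = exp \<bar>Im \<rho>\<bar>"
      have E: "E > 0" by (simp add: E_def)
      have sin: "norm (sin \<rho>) \<ge> E / 4"
        unfolding E_def using or unfolding N_def by (rule norm_sin_ge_on_square)
      have r: "norm (W (\<rho>\<^sup>2) - \<rho> * sin \<rho>) \<le> C1 * E" "norm (F (\<rho>\<^sup>2) * W (\<rho>\<^sup>2)) \<le> C2 * E"
        using R[of \<rho>] n(2) \<rho> by (auto simp: E_def)
      have "norm \<rho> * (E / 4) \<le> norm \<rho> * norm (sin \<rho>)" using sin by (intro mult_left_mono) auto
      moreover have "norm \<rho> * norm (sin \<rho>) \<le> norm (W (\<rho>\<^sup>2)) + C1 * E"
        using norm_triangle_ineq4[of "W (\<rho>\<^sup>2)" "W (\<rho>\<^sup>2) - \<rho> * sin \<rho>"] r(1) by (simp add: norm_mult)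
      moreover have "N n * E \<le> norm \<rho> * E" using \<rho> E by (intro mult_right_mono) auto
      moreover have "8 * C1 * E \<le> N n * E" using n(3) E by (intro mult_right_mono) auto
      ultimately have "N n * E / 8 \<le> norm (W (\<rho>\<^sup>2))" by linarith
      hence "norm (F (\<rho>\<^sup>2)) * (N n * E / 8) \<le> norm (F (\<rho>\<^sup>2)) * norm (W (\<rho>\<^sup>2))"
        by (intro mult_left_mono) auto
      also have "\<dots> \<le> C2 * E" using r(2) by (simp add: norm_mult)
      finally show "norm (F (\<rho>\<^sup>2)) \<le> 8 * C2 / N n" using E n(1) by (simp add: field_simps)
    qed auto
    thus ?case by (simp add: w_def)
  qed
  have "(\<lambda>n. 8 * C2 / N n) \<longlonglongrightarrow> 0"
    by (rule tendsto_divide_0[OF tendsto_const filterlim_at_top_imp_at_infinity[OF N]])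
  from tendsto_lowerbound[OF this bound] show ?thesis by simp
qed

text \<open>
  At a common zero both functions are the same power of \<open>w - z0\<close> times a nonvanishing factor, so \<open>f / g\<close>
  has only removable singularities.
\<close>
lemma entire_quotient_same_zeros:
  assumes f: "f holomorphic_on UNIV" "\<exists>z. f z \<noteq> 0" and g: "g holomorphic_on UNIV" "\<exists>z. g z \<noteq> 0"
    and z: "\<And>z. f z = 0 \<longleftrightarrow> g z = 0" "\<And>z. f z = 0 \<Longrightarrow> zorder f z = zorder g z"
  obtains h where "h holomorphic_on UNIV" "\<And>z. f z = h z * g z"
proof -
  define h where "h = remove_sings (\<lambda>z. f z / g z)"
  have "h analytic_on {z0}" for z0
  proof -
    have "\<exists>w\<in>UNIV. f w \<noteq> 0" "\<exists>w\<in>UNIV. g w \<noteq> 0" using f(2) g(2) by auto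
    note zf = zorder_exist_zero[OF f(1) open_UNIV connected_UNIV UNIV_I this(1), of z0]
      and zg = zorder_exist_zero[OF g(1) open_UNIV connected_UNIV UNIV_I this(2), of z0]
    obtain r1 where r1: "r1 > 0" "zor_poly f z0 holomorphic_on cball z0 r1"
        "\<And>w. w \<in> cball z0 r1 \<Longrightarrow> f w = zor_poly f z0 w * (w - z0) ^ nat (zorder f z0) \<and> zor_poly f z0 w \<noteq> 0"
      using zf[THEN conjunct2] by blast
    obtain r2 where r2: "r2 > 0" "zor_poly g z0 holomorphic_on cball z0 r2"
        "\<And>w. w \<in> cball z0 r2 \<Longrightarrow> g w = zor_poly g z0 w * (w - z0) ^ nat (zorder g z0) \<and> zor_poly g z0 w \<noteq> 0"
      using zg[THEN conjunct2] by blast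
    have eq: "zorder f z0 = zorder g z0"
      using zf[THEN conjunct1] zg[THEN conjunct1] z[of z0] by metis
    define r where "r = min r1 r2"
    have r: "r > 0" using r1(1) r2(1) by (simp add: r_def)
    have q: "f w / g w = zor_poly f z0 w / zor_poly g z0 w" if "w \<in> ball z0 r - {z0}" for w
      using that r1(3)[of w] r2(3)[of w] eq by (simp add: r_def)
    have hol: "(\<lambda>w. zor_poly f z0 w / zor_poly g z0 w) holomorphic_on ball z0 r"
      using r2(3) by (intro holomorphic_intros holomorphic_on_subset[OF r1(2)] holomorphic_on_subset[OF r2(2)])
        (auto simp: r_def)
    hence "(\<lambda>w. f w / g w) holomorphic_on ball z0 r - {z0}"
      using q by (subst holomorphic_cong[OF refl]) (auto intro: holomorphic_on_subset)
    hence "isolated_singularity_at (\<lambda>w. f w / g w) z0"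
      using r by (intro isolated_singularity_at_holomorphic[of _ "ball z0 r"]) auto
    moreover have "(\<lambda>w. zor_poly f z0 w / zor_poly g z0 w) \<midarrow>z0\<rightarrow> zor_poly f z0 z0 / zor_poly g z0 z0"
      using holomorphic_on_imp_continuous_on[OF hol] r
      by (simp add: continuous_on_eq_continuous_at isCont_def)
    hence "(\<lambda>w. f w / g w) \<midarrow>z0\<rightarrow> zor_poly f z0 z0 / zor_poly g z0 z0"
    proof (rule Lim_transform_within_open[of _ _ _ _ "ball z0 r"])
    qed (use r q in auto)
    ultimately show ?thesis unfolding h_def by (rule remove_sings_analytic_at)
  qed
  hence "h analytic_on UNIV" using analytic_on_analytic_at by blast
  hence 1: "h holomorphic_on UNIV" by (simp add: analytic_on_open)
  have 2: "f z0 = h z0 * g z0" for z0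
  proof (cases "g z0 = 0")
    case False
    have "f analytic_on {z0}" "g analytic_on {z0}"
      using f(1) g(1) by (auto intro: holomorphic_on_imp_analytic_at)
    hence "h z0 = f z0 / g z0"
      unfolding h_def using False by (intro remove_sings_at_analytic analytic_intros) auto
    thus ?thesis using False by simp
  qed (use z(1) in auto)
  from 1 2 show ?thesis by (rule that)
qed

text \<open>Otherwise the division principle would apply to the constant function 1.\<close>
lemma sine_type_not_identically_0:
  assumes "(\<lambda>\<rho>. W (\<rho>\<^sup>2) - \<rho> * sin \<rho>) \<in> O[at_infinity](growth 1)"
  shows "\<exists>z. W z \<noteq> 0"
proof (rule ccontr)
  assume "\<not> ?thesis"
  hence "(1 :: complex) = 0"
    using entire_eq_0_by_sine_type_division[of "\<lambda>_. 1", OF _ assms] by simp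
  thus False by simp
qed

text \<open>The division principle for \<open>F = h - 1\<close>, where \<open>h\<close> is the entire quotient \<open>f / g\<close>.\<close>
lemma sine_type_determined_by_zeros:
  assumes f: "f holomorphic_on UNIV" "(\<lambda>\<rho>. f (\<rho>\<^sup>2) - \<rho> * sin \<rho>) \<in> O[at_infinity](growth 1)"
    and g: "g holomorphic_on UNIV" "(\<lambda>\<rho>. g (\<rho>\<^sup>2) - \<rho> * sin \<rho>) \<in> O[at_infinity](growth 1)"
    and z: "\<And>z. f z = 0 \<longleftrightarrow> g z = 0" "\<And>z. f z = 0 \<Longrightarrow> zorder f z = zorder g z"
  shows "f z = g z"
proof -
  obtain h where h: "h holomorphic_on UNIV" "\<And>z. f z = h z * g z"
    using entire_quotient_same_zeros[OF f(1) sine_type_not_identically_0[OF f(2)]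
        g(1) sine_type_not_identically_0[OF g(2)] z] by metis
  have "(\<lambda>\<rho>. (f (\<rho>\<^sup>2) - \<rho> * sin \<rho>) - (g (\<rho>\<^sup>2) - \<rho> * sin \<rho>)) \<in> O[at_infinity](growth 1)"
    by (intro sum_in_bigo f g)
  hence "(\<lambda>\<rho>. (h (\<rho>\<^sup>2) - 1) * g (\<rho>\<^sup>2)) \<in> O[at_infinity](growth 1)"
    by (simp add: h(2) algebra_simps)
  hence "h z - 1 = 0"
    using h(1) g(2) by (intro entire_eq_0_by_sine_type_division[where F = "\<lambda>z. h z - 1" and W = g])
      (auto intro: holomorphic_intros)
  thus ?thesis by (simp add: h(2))
qed

section \<open>Solutions with data at the right endpoint\<close>
lemma continuous_on_reflect:
  "continuous_on {0..1} q \<Longrightarrow> continuous_on {0..1} (\<lambda>x::real. q (1 - x))"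
  by (rule continuous_on_compose2[of "{0..1}" q]) (auto intro!: continuous_intros)

lemma solves_unique_terminal:
  assumes q: "continuous_on {0..1} q" and y: "solves q z y1" "solves q z y2"
    and 1: "y1 1 = y2 1" "deriv01 y1 1 = deriv01 y2 1" and x: "x \<in> {0..1}"
  shows "y1 x = y2 x" "deriv01 y1 x = deriv01 y2 x"
proof -
  have *: "y1 x = y2 x" if "x \<in> {0..1}" for x
    using solves_unique(1)[OF continuous_on_reflect[OF q] solves_reflect(1)[OF y(1)] solves_reflect(1)[OF y(2)],
        of "1 - x"] that by (simp add: 1 solves_reflect(2)[OF y(1)] solves_reflect(2)[OF y(2)])
  show "y1 x = y2 x" using *[OF x] .
  show "deriv01 y1 x = deriv01 y2 x" by (intro deriv01_cong * x)
qed

text \<open>The sign of \<open>d\<close> changes because the reflection reverses derivatives.\<close>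
definition terminal_solution ::
    "(real \<Rightarrow> real) \<Rightarrow> complex \<Rightarrow> complex \<Rightarrow> complex \<Rightarrow> real \<Rightarrow> complex" where
  "terminal_solution q z c d = (\<lambda>x. ivp_solution (\<lambda>x. q (1 - x)) z c (- d) (1 - x))"

lemma terminal_solution:
  assumes q: "continuous_on {0..1} q"
  shows "solves q z (terminal_solution q z c d)"
    and "terminal_solution q z c d 1 = c" and "deriv01 (terminal_solution q z c d) 1 = d"
    and "\<And>x. x \<in> {0..1} \<Longrightarrow> deriv01 (terminal_solution q z c d) x =
              - deriv01 (ivp_solution (\<lambda>x. q (1 - x)) z c (- d)) (1 - x)"
proof -
  note i = ivp_solution[OF continuous_on_reflect[OF q], of z c "- d"]
  note r = solves_reflect[OF i(1), folded terminal_solution_def]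
  show "solves q z (terminal_solution q z c d)" using r(1) by simp
  show "terminal_solution q z c d 1 = c" by (simp add: terminal_solution_def i)
  show "deriv01 (terminal_solution q z c d) 1 = d" using r(2)[of 1] by (simp add: i)
  show "\<And>x. x \<in> {0..1} \<Longrightarrow> deriv01 (terminal_solution q z c d) x =
              - deriv01 (ivp_solution (\<lambda>x. q (1 - x)) z c (- d)) (1 - x)" by (rule r(2))
qed

lemma terminal_solution_holomorphic:
  assumes q: "continuous_on {0..1} q" and x: "x \<in> {0..1}"
  shows "(\<lambda>z. terminal_solution q z c d x) holomorphic_on UNIV"
    and "(\<lambda>z. deriv01 (terminal_solution q z c d) x) holomorphic_on UNIV"
proof -
  have x': "1 - x \<in> {0..1}" using x by auto
  note h = ivp_solution_holomorphic[OF continuous_on_reflect[OF q] x']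
  show "(\<lambda>z. terminal_solution q z c d x) holomorphic_on UNIV"
    unfolding terminal_solution_def by (rule h)
  show "(\<lambda>z. deriv01 (terminal_solution q z c d) x) holomorphic_on UNIV"
    unfolding terminal_solution(4)[OF q x] by (intro holomorphic_intros h)
qed

lemma ivp_solution_asymptotics:
  assumes q: "continuous_on {0..1} q" and x: "x \<in> {0..1}"
  shows "(\<lambda>\<rho>. ivp_solution q (\<rho>\<^sup>2) c d x - c * cos (of_real x * \<rho>)) \<in> O[at_infinity](\<lambda>\<rho>. growth x \<rho> / \<rho>)"
    and "(\<lambda>\<rho>. deriv01 (ivp_solution q (\<rho>\<^sup>2) c d) x + c * \<rho> * sin (of_real x * \<rho>)) \<in> O[at_infinity](growth x)"
  using solution_asymptotics[OF q ivp_solution(1)[OF q] ivp_solution(2)[OF q] ivp_solution(3)[OF q] x] .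

lemma terminal_solution_asymptotics:
  assumes q: "continuous_on {0..1} q" and x: "x \<in> {0..1}"
  shows "(\<lambda>\<rho>. terminal_solution q (\<rho>\<^sup>2) c d x - c * cos (of_real (1 - x) * \<rho>))
           \<in> O[at_infinity](\<lambda>\<rho>. growth (1 - x) \<rho> / \<rho>)"
    and "(\<lambda>\<rho>. deriv01 (terminal_solution q (\<rho>\<^sup>2) c d) x - c * \<rho> * sin (of_real (1 - x) * \<rho>))
           \<in> O[at_infinity](growth (1 - x))"
proof -
  have x': "1 - x \<in> {0..1}" using x by auto
  note a = ivp_solution_asymptotics[OF continuous_on_reflect[OF q] x', of c "- d"]
  show "(\<lambda>\<rho>. terminal_solution q (\<rho>\<^sup>2) c d x - c * cos (of_real (1 - x) * \<rho>))
           \<in> O[at_infinity](\<lambda>\<rho>. growth (1 - x) \<rho> / \<rho>)"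
    unfolding terminal_solution_def by (rule a(1))
  have "(\<lambda>\<rho>. - (deriv01 (terminal_solution q (\<rho>\<^sup>2) c d) x - c * \<rho> * sin (of_real (1 - x) * \<rho>)))
           \<in> O[at_infinity](growth (1 - x))"
    unfolding terminal_solution(4)[OF q x] using a(2) by (simp add: add.commute)
  thus "(\<lambda>\<rho>. deriv01 (terminal_solution q (\<rho>\<^sup>2) c d) x - c * \<rho> * sin (of_real (1 - x) * \<rho>))
           \<in> O[at_infinity](growth (1 - x))"
    by (simp only: landau_o.big.uminus_in_iff)
qed

lemma times_growth_divide_bigo:
  assumes "f \<in> O[at_infinity](\<lambda>\<rho>. growth x \<rho> / \<rho>)"
  shows "(\<lambda>\<rho>. \<rho> * f \<rho>) \<in> O[at_infinity](growth x)"
proof -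
  have "(\<lambda>\<rho>. \<rho> * f \<rho>) \<in> O[at_infinity](\<lambda>\<rho>. \<rho> * (growth x \<rho> / \<rho>))"
    using assms by (rule landau_o.big.mult_left)
  moreover have "(\<lambda>\<rho>. \<rho> * (growth x \<rho> / \<rho>)) \<in> O[at_infinity](growth x)"
    by (rule bigoI[where c = 1]) (auto simp: norm_mult norm_divide)
  ultimately show ?thesis by (rule landau_o.big_trans)
qed

text \<open>
  The leading terms combine by the addition theorem, \<open>cos (\<rho> x) * \<rho> sin (\<rho> (1 - x)) + \<rho> sin (\<rho> x) *
  cos (\<rho> (1 - x)) = \<rho> sin \<rho>\<close>. The four functions need not come from one and the same equation; this
  freedom is what the comparison of two problems uses.
\<close>
lemma cross_wronskian_asymptotics:
  assumes x: "x \<in> {0..1}"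
    and A: "(\<lambda>\<rho>. A \<rho> - cos (of_real x * \<rho>)) \<in> O[at_infinity](\<lambda>\<rho>. growth x \<rho> / \<rho>)"
    and A': "(\<lambda>\<rho>. A' \<rho> + \<rho> * sin (of_real x * \<rho>)) \<in> O[at_infinity](growth x)"
    and B: "(\<lambda>\<rho>. B \<rho> - cos (of_real (1 - x) * \<rho>)) \<in> O[at_infinity](\<lambda>\<rho>. growth (1 - x) \<rho> / \<rho>)"
    and B': "(\<lambda>\<rho>. B' \<rho> - \<rho> * sin (of_real (1 - x) * \<rho>)) \<in> O[at_infinity](growth (1 - x))"
  shows "(\<lambda>\<rho>. A \<rho> * B' \<rho> - A' \<rho> * B \<rho> - \<rho> * sin \<rho>) \<in> O[at_infinity](growth 1)"
proof -
  have x01: "x \<ge> 0" "1 - x \<ge> 0" using x by auto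
  define c1 s1 c2 s2 where "c1 = (\<lambda>\<rho>::complex. cos (of_real x * \<rho>))" "s1 = (\<lambda>\<rho>::complex. sin (of_real x * \<rho>))"
    "c2 = (\<lambda>\<rho>::complex. cos (of_real (1 - x) * \<rho>))" "s2 = (\<lambda>\<rho>::complex. sin (of_real (1 - x) * \<rho>))"
  note defs = this
  have prod: "(\<lambda>\<rho>. f \<rho> * g \<rho>) \<in> O[at_infinity](growth 1)"
    if "f \<in> O[at_infinity](growth x)" "g \<in> O[at_infinity](growth (1 - x))" for f g
    using landau_o.big.mult[OF that] by (simp add: growth_mult)
  have trig: "c1 \<in> O[at_infinity](growth x)" "s1 \<in> O[at_infinity](growth x)"
     "c2 \<in> O[at_infinity](growth (1 - x))" "s2 \<in> O[at_infinity](growth (1 - x))"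
    unfolding defs by (rule cos_growth sin_growth x01)+
  have sin: "sin \<rho> = c1 \<rho> * s2 \<rho> + s1 \<rho> * c2 \<rho>" for \<rho>
    unfolding defs using sin_add[of "of_real x * \<rho>" "of_real (1 - x) * \<rho>"] by (simp add: algebra_simps)
  have A: "(\<lambda>\<rho>. A \<rho> - c1 \<rho>) \<in> O[at_infinity](\<lambda>\<rho>. growth x \<rho> / \<rho>)"
    and A': "(\<lambda>\<rho>. A' \<rho> + \<rho> * s1 \<rho>) \<in> O[at_infinity](growth x)"
    and B: "(\<lambda>\<rho>. B \<rho> - c2 \<rho>) \<in> O[at_infinity](\<lambda>\<rho>. growth (1 - x) \<rho> / \<rho>)"
    and B': "(\<lambda>\<rho>. B' \<rho> - \<rho> * s2 \<rho>) \<in> O[at_infinity](growth (1 - x))"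
    unfolding defs by (rule A A' B B')+
  note A1 = growth_divide_bigo[OF A] and A2 = times_growth_divide_bigo[OF A]
    and B1 = growth_divide_bigo[OF B] and B2 = times_growth_divide_bigo[OF B]
  \<comment> \<open>The factor \<open>\<rho>\<close> of a main term is always moved to the error of the other function, which has a
    \<open>1 / \<rho>\<close> to spare.\<close>
  have "(\<lambda>\<rho>. (A \<rho> - c1 \<rho>) * (B' \<rho> - \<rho> * s2 \<rho>) + (\<rho> * (A \<rho> - c1 \<rho>)) * s2 \<rho>
           + c1 \<rho> * (B' \<rho> - \<rho> * s2 \<rho>) - (A' \<rho> + \<rho> * s1 \<rho>) * (B \<rho> - c2 \<rho>)
           - (A' \<rho> + \<rho> * s1 \<rho>) * c2 \<rho> + s1 \<rho> * (\<rho> * (B \<rho> - c2 \<rho>))) \<in> O[at_infinity](growth 1)"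
    by (intro sum_in_bigo prod[OF A1 B'] prod[OF A2 trig(4)] prod[OF trig(1) B'] prod[OF A' B1]
          prod[OF A' trig(3)] prod[OF trig(2) B2])
  also have "(\<lambda>\<rho>. (A \<rho> - c1 \<rho>) * (B' \<rho> - \<rho> * s2 \<rho>) + (\<rho> * (A \<rho> - c1 \<rho>)) * s2 \<rho>
           + c1 \<rho> * (B' \<rho> - \<rho> * s2 \<rho>) - (A' \<rho> + \<rho> * s1 \<rho>) * (B \<rho> - c2 \<rho>)
           - (A' \<rho> + \<rho> * s1 \<rho>) * c2 \<rho> + s1 \<rho> * (\<rho> * (B \<rho> - c2 \<rho>)))
        = (\<lambda>\<rho>. A \<rho> * B' \<rho> - A' \<rho> * B \<rho> - \<rho> * sin \<rho>)"
    by (rule ext) (simp add: sin algebra_simps)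
  finally show ?thesis .
qed

text \<open>Because \<open>cos (2 * a) = 2 * (cos a)\<^sup>2 - 1\<close>, a limit 0 would force 0 = -1 along the even indices.\<close>
lemma cos_not_tendsto_0: "\<not> (\<lambda>n. cos (of_real x * of_nat n :: complex)) \<longlonglongrightarrow> 0"
proof
  assume *: "(\<lambda>n. cos (of_real x * of_nat n :: complex)) \<longlonglongrightarrow> 0"
  have d: "cos (of_real x * of_nat (2 * n) :: complex) = 2 * cos (of_real x * of_nat n) ^ 2 - 1" for n
  proof -
    have "of_real x * of_nat (2 * n) = 2 * (of_real x * of_nat n :: complex)" by simp
    thus ?thesis by (simp only: cos_double_cos)
  qed
  have "(\<lambda>n. cos (of_real x * of_nat (2 * n) :: complex)) \<longlonglongrightarrow> 0"
    using LIMSEQ_subseq_LIMSEQ[OF *, of "\<lambda>n. 2 * n"] by (simp add: o_def strict_mono_def)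
  moreover have "(\<lambda>n. 2 * cos (of_real x * of_nat n :: complex) ^ 2 - 1) \<longlonglongrightarrow> 2 * 0 ^ 2 - 1"
    by (intro tendsto_intros *)
  ultimately have "(0::complex) = 2 * 0 ^ 2 - 1" unfolding d by (rule LIMSEQ_unique)
  thus False by simp
qed

lemma ivp_solution_not_identically_0:
  assumes q: "continuous_on {0..1} q" and x: "x \<in> {0..1}"
  shows "\<exists>z. ivp_solution q z 1 d x \<noteq> 0"
proof (rule ccontr)
  assume "\<not> ?thesis"
  hence "(\<lambda>\<rho>. - cos (of_real x * \<rho>)) \<in> O[at_infinity](\<lambda>\<rho>. growth x \<rho> / \<rho>)"
    using ivp_solution_asymptotics(1)[OF q x, of 1 d] by simp
  from bigo_growth_real_tendsto_0[OF this] cos_not_tendsto_0[of x] show False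
    by (simp add: tendsto_minus_cancel_left[symmetric])
qed

section \<open>Characteristic determinants\<close>
lemma ivp_solution_expand:
  assumes q: "continuous_on {0..1} q" and y: "solves q z y" and x: "x \<in> {0..1}"
  shows "y x = y 0 * ivp_solution q z 1 0 x + deriv01 y 0 * ivp_solution q z 0 1 x"
    and "deriv01 y x = y 0 * deriv01 (ivp_solution q z 1 0) x + deriv01 y 0 * deriv01 (ivp_solution q z 0 1) x"
proof -
  note l = solves_linear[OF ivp_solution(1)[OF q, of z 1 0] ivp_solution(1)[OF q, of z 0 1],
     where a = "y 0" and b = "deriv01 y 0"]
  note u = solves_unique[OF q y l(1) _ _ x]
  show "y x = y 0 * ivp_solution q z 1 0 x + deriv01 y 0 * ivp_solution q z 0 1 x"
    by (rule u(1)) (simp_all add: l(2) ivp_solution[OF q])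
  show "deriv01 y x = y 0 * deriv01 (ivp_solution q z 1 0) x + deriv01 y 0 * deriv01 (ivp_solution q z 0 1) x"
    by (subst u(2)) (use x in \<open>simp_all add: l(2) ivp_solution[OF q]\<close>)
qed

lemma char_det_eq:
  "char_det q U1 U2 z =
     U1 (ivp_solution q z 1 0) * U2 (ivp_solution q z 0 1) - U1 (ivp_solution q z 0 1) * U2 (ivp_solution q z 1 0)"
  by (simp add: char_det_def Let_def det_2 vector_2)

lemma eigenvalue_iff_char_det:
  fixes a11 a12 a21 a22 :: real
  defines "U1 \<equiv> form_mixed0 a11 a12" and "U2 \<equiv> form_mixed1 a21 a22"
  assumes q: "continuous_on {0..1} q"
  shows "eigenvalue q U1 U2 z \<longleftrightarrow> char_det q U1 U2 z = 0"
proof -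
  define C S where "C = ivp_solution q z 1 0" and "S = ivp_solution q z 0 1"
  note C = ivp_solution[OF q, of z 1 0, folded C_def] and S = ivp_solution[OF q, of z 0 1, folded S_def]
  note ex = ivp_solution_expand[OF q, of z, folded C_def S_def]
  have U: "U1 y = y 0 * U1 C + deriv01 y 0 * U1 S" "U2 y = y 0 * U2 C + deriv01 y 0 * U2 S"
    if "solves q z y" for y
    using ex(1)[OF that, of 1] ex(2)[OF that, of 1]
    by (simp_all add: U1_def U2_def form_mixed0_def form_mixed1_def C S algebra_simps)
  have det: "char_det q U1 U2 z = U1 C * U2 S - U1 S * U2 C"
    by (simp add: char_det_eq C_def S_def)
  show ?thesis
  proof
    assume "eigenvalue q U1 U2 z"
    then obtain y x where y: "solves q z y" "x \<in> {0..1}" "y x \<noteq> 0" "U1 y = 0" "U2 y = 0"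
      by (auto simp: eigenvalue_def)
    have "y 0 \<noteq> 0 \<or> deriv01 y 0 \<noteq> 0" using ex(1)[OF y(1,2)] y(3) by auto
    moreover have e: "y 0 * U1 C + deriv01 y 0 * U1 S = 0" "y 0 * U2 C + deriv01 y 0 * U2 S = 0"
      using U[OF y(1)] y by simp_all
    have "y 0 * (U1 C * U2 S - U1 S * U2 C) =
        U2 S * (y 0 * U1 C + deriv01 y 0 * U1 S) - U1 S * (y 0 * U2 C + deriv01 y 0 * U2 S)"
      "deriv01 y 0 * (U1 C * U2 S - U1 S * U2 C) =
        U1 C * (y 0 * U2 C + deriv01 y 0 * U2 S) - U2 C * (y 0 * U1 C + deriv01 y 0 * U1 S)"
      by (simp_all add: algebra_simps)
    hence "y 0 * (U1 C * U2 S - U1 S * U2 C) = 0" "deriv01 y 0 * (U1 C * U2 S - U1 S * U2 C) = 0"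
      unfolding e by simp_all
    ultimately show "char_det q U1 U2 z = 0" unfolding det by auto
  next
    assume "char_det q U1 U2 z = 0"
    hence d: "U1 C * U2 S - U1 S * U2 C = 0" by (simp add: det)
    have "\<exists>a b. (a \<noteq> 0 \<or> b \<noteq> 0) \<and> a * U1 C + b * U1 S = 0 \<and> a * U2 C + b * U2 S = 0"
    proof (cases "U1 C = 0 \<and> U1 S = 0")
      case True
      thus ?thesis
      proof (cases "U2 C = 0 \<and> U2 S = 0")
        case True
        with \<open>U1 C = 0 \<and> U1 S = 0\<close> show ?thesis by (intro exI[of _ 1]) auto
      next
        case False
        with \<open>U1 C = 0 \<and> U1 S = 0\<close> show ?thesis
          by (intro exI[of _ "U2 S"] exI[of _ "- U2 C"]) (auto simp: algebra_simps)
      qed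
    next
      case False
      thus ?thesis using d
        by (intro exI[of _ "U1 S"] exI[of _ "- U1 C"]) (auto simp: algebra_simps)
    qed
    then obtain a b where ab: "a \<noteq> 0 \<or> b \<noteq> 0" "a * U1 C + b * U1 S = 0" "a * U2 C + b * U2 S = 0"
      by blast
    note l = solves_linear[OF C(1) S(1), where a = a and b = b]
    define y where "y = (\<lambda>x. a * C x + b * S x)"
    have y: "solves q z y" "y 0 = a" "deriv01 y 0 = b"
      using l by (simp_all add: y_def C S)
    have "\<exists>x\<in>{0..1}. y x \<noteq> 0"
    proof (rule ccontr)
      assume "\<not> ?thesis"
      hence y0: "y x = 0" if "x \<in> {0..1}" for x using that by blast
      have "deriv01 y 0 = deriv01 (\<lambda>_. 0) 0" by (rule deriv01_cong) (auto simp: y0)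
      also have "\<dots> = 0" by (rule deriv01_eqI) auto
      finally show False using y0[of 0] y ab(1) by simp
    qed
    moreover have "U1 y = 0" "U2 y = 0" using U[OF y(1)] ab y by simp_all
    ultimately show "eigenvalue q U1 U2 z" using y(1) by (auto simp: eigenvalue_def)
  qed
qed

text \<open>
  Up to terms of lower growth the determinant of the problem with mixed conditions is that of a separated
  problem, because the products of values at 1 combine to the Wronskian of the two basic solutions.
\<close>
lemma char_det_mixed:
  fixes a11 a12 a21 a22 :: real
  assumes q: "continuous_on {0..1} q"
  defines "\<phi> \<equiv> \<lambda>z. ivp_solution q z 1 (- of_real a11)"
  shows "char_det q (form_mixed0 a11 a12) (form_mixed1 a21 a22) z =
           - (deriv01 (\<phi> z) 1 + of_real a22 * \<phi> z 1)
           + of_real (a12 - a21) - of_real (a12 * a21) * ivp_solution q z 0 1 1"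
proof -
  define C S where "C = ivp_solution q z 1 0" and "S = ivp_solution q z 0 1"
  note C = ivp_solution[OF q, of z 1 0, folded C_def] and S = ivp_solution[OF q, of z 0 1, folded S_def]
  note P = ivp_solution[OF q, of z 1 "- of_real a11"]
  have e: "\<phi> z 1 = C 1 - of_real a11 * S 1" "deriv01 (\<phi> z) 1 = deriv01 C 1 - of_real a11 * deriv01 S 1"
    using ivp_solution_expand[OF q P(1), of 1] unfolding P \<phi>_def C_def S_def by simp_all
  have w: "C 1 * deriv01 S 1 - deriv01 C 1 * S 1 = 1"
    using wronskian_constant[OF C(1) S(1), of 0] by (simp add: C S)
  have "char_det q (form_mixed0 a11 a12) (form_mixed1 a21 a22) z =
         (0 + of_real a11 * 1 + of_real a12 * C 1) * (deriv01 S 1 + of_real a21 * 0 + of_real a22 * S 1)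
         - (1 + of_real a11 * 0 + of_real a12 * S 1) * (deriv01 C 1 + of_real a21 * 1 + of_real a22 * C 1)"
    by (simp only: char_det_eq form_mixed0_def form_mixed1_def C_def[symmetric] S_def[symmetric] C S)
  also have "\<dots> = - (deriv01 (\<phi> z) 1 + of_real a22 * \<phi> z 1) + of_real (a12 - a21) - of_real (a12 * a21) * S 1
          + of_real a12 * (C 1 * deriv01 S 1 - deriv01 C 1 * S 1 - 1)"
    unfolding e by (simp add: algebra_simps)
  finally show ?thesis unfolding w S_def[symmetric] by simp
qed

text \<open>The separated problems are the mixed ones with vanishing coupling constants.\<close>
lemma form_mixed_0: "form_mixed0 a 0 = form0 a" "form_mixed1 0 a = form1 a"
  by (auto simp: form_mixed0_def form_mixed1_def form0_def form1_def)

lemma char_det_separated: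
  fixes h H :: real
  assumes q: "continuous_on {0..1} q"
  defines "\<phi> \<equiv> \<lambda>z. ivp_solution q z 1 (- of_real h)"
  shows "char_det q (form0 h) (form1 H) z = - (deriv01 (\<phi> z) 1 + of_real H * \<phi> z 1)"
  using char_det_mixed[OF q, of h 0 0 H z] by (simp add: form_mixed_0 \<phi>_def)

lemma same_eigenvalue_lists:
  assumes "eigenvalue_list q U1 U2 ev" "eigenvalue_list qt V1 V2 evt" "same_multiset ev evt"
  shows "eigenvalue q U1 U2 z \<longleftrightarrow> eigenvalue qt V1 V2 z"
    and "eigenvalue q U1 U2 z \<Longrightarrow> zorder (char_det q U1 U2) z = zorder (char_det qt V1 V2) z"
proof -
  obtain p where p: "bij p" "\<And>k. ev k = evt (p k)"
    using assms(3) by (auto simp: same_multiset_def)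
  have "range ev = evt ` range p" by (auto simp: p(2))
  also have "\<dots> = range evt" using bij_is_surj[OF p(1)] by simp
  finally show 1: "eigenvalue q U1 U2 z \<longleftrightarrow> eigenvalue qt V1 V2 z"
    using assms(1,2) by (metis (no_types, lifting) eigenvalue_list_def mem_Collect_eq)
  have "p ` (p -` {k. evt k = z}) = {k. evt k = z}"
    using bij_is_surj[OF p(1)] by (rule surj_image_vimage_eq)
  hence "p ` {k. ev k = z} = {k. evt k = z}" by (simp add: vimage_def p(2))
  hence "card {k. ev k = z} = card {k. evt k = z}"
    using card_image[OF inj_on_subset[OF bij_is_inj[OF p(1)] subset_UNIV], of "{k. ev k = z}"] by simp
  moreover assume "eigenvalue q U1 U2 z"
  moreover from this 1 have "eigenvalue qt V1 V2 z" by simp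
  ultimately have "int (card {k. evt k = z}) = zorder (char_det q U1 U2) z"
    "int (card {k. evt k = z}) = zorder (char_det qt V1 V2) z"
    using assms(1,2) by (auto simp: eigenvalue_list_def)
  thus "zorder (char_det q U1 U2) z = zorder (char_det qt V1 V2) z" by simp
qed

lemma char_det_holomorphic:
  assumes q: "continuous_on {0..1} q"
  shows "char_det q (form_mixed0 a11 a12) (form_mixed1 a21 a22) holomorphic_on UNIV"
  unfolding char_det_mixed[OF q, abs_def]
  by (intro holomorphic_intros ivp_solution_holomorphic q) auto

text \<open>
  Four potentials and four sets of data are allowed. For a single potential and equal data on each side
  the expression contains a Wronskian, which is independent of \<open>x\<close>; with two problems it contains the
  mixed Wronskian in which they are compared.
\<close>
lemma left_right_asymptotics:
  assumes q: "continuous_on {0..1} q" "continuous_on {0..1} q1" "continuous_on {0..1} q2" "continuous_on {0..1} q3"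
    and x: "x \<in> {0..1}"
  shows "(\<lambda>\<rho>. ivp_solution q (\<rho>\<^sup>2) 1 c0 x * deriv01 (terminal_solution q1 (\<rho>\<^sup>2) 1 c1) x
            - deriv01 (ivp_solution q2 (\<rho>\<^sup>2) 1 c2) x * terminal_solution q3 (\<rho>\<^sup>2) 1 c3 x - \<rho> * sin \<rho>)
          \<in> O[at_infinity](growth 1)"
  using ivp_solution_asymptotics[OF q(1) x, of 1 c0] ivp_solution_asymptotics[OF q(3) x, of 1 c2]
    terminal_solution_asymptotics[OF q(2) x, of 1 c1] terminal_solution_asymptotics[OF q(4) x, of 1 c3]
  by (intro cross_wronskian_asymptotics[OF x]) simp_all

lemma left_right_wronskian:
  assumes q: "continuous_on {0..1} q" and x: "x \<in> {0..1}"
  shows "ivp_solution q z 1 c x * deriv01 (terminal_solution q z 1 d) x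
            - deriv01 (ivp_solution q z 1 c) x * terminal_solution q z 1 d x =
         ivp_solution q z 1 c 1 * d - deriv01 (ivp_solution q z 1 c) 1"
  using wronskian_constant[OF ivp_solution(1)[OF q] terminal_solution(1)[OF q] x, of z 1 c 1 d]
  by (simp add: terminal_solution[OF q])

lemma char_det_asymptotics:
  assumes q: "continuous_on {0..1} q"
  shows "(\<lambda>\<rho>. char_det q (form_mixed0 a11 a12) (form_mixed1 a21 a22) (\<rho>\<^sup>2) - \<rho> * sin \<rho>)
          \<in> O[at_infinity](growth 1)"
proof -
  define \<phi> where "\<phi> = (\<lambda>z. ivp_solution q z 1 (- of_real a11))"
  have f1: "(\<lambda>\<rho>. (\<phi> (\<rho>\<^sup>2) 1 * (- of_real a22) - deriv01 (\<phi> (\<rho>\<^sup>2)) 1) - \<rho> * sin \<rho>) \<in> O[at_infinity](growth 1)"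
    unfolding \<phi>_def using left_right_asymptotics[OF q q q q, of 1 "- of_real a11" "- of_real a22" "- of_real a11" "- of_real a22"]
    unfolding left_right_wronskian[OF q, of 1] by (simp add: terminal_solution[OF q])
  have f2: "(\<lambda>\<rho>. of_real (a12 - a21) :: complex) \<in> O[at_infinity](growth 1)"
    by (rule bigoI[where c = "\<bar>a12 - a21\<bar>"]) (auto simp: norm_growth mult_le_cancel_left1 simp del: of_real_diff)
  have "(\<lambda>\<rho>. ivp_solution q (\<rho>\<^sup>2) 0 1 1) \<in> O[at_infinity](growth 1)"
    using growth_divide_bigo[OF ivp_solution_asymptotics(1)[OF q, of 1 0 1]] by simp
  hence "(\<lambda>\<rho>. of_real c * ivp_solution q (\<rho>\<^sup>2) 0 1 1) \<in> O[at_infinity](growth 1)" for c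
    by (cases "c = 0") simp_all
  from this[of "a12 * a21"]
  have f3: "(\<lambda>\<rho>. of_real (a12 * a21) * ivp_solution q (\<rho>\<^sup>2) 0 1 1) \<in> O[at_infinity](growth 1)" .
  have "(\<lambda>\<rho>. ((\<phi> (\<rho>\<^sup>2) 1 * (- of_real a22) - deriv01 (\<phi> (\<rho>\<^sup>2)) 1) - \<rho> * sin \<rho>)
        + of_real (a12 - a21) - of_real (a12 * a21) * ivp_solution q (\<rho>\<^sup>2) 0 1 1) \<in> O[at_infinity](growth 1)"
    by (rule sum_in_bigo(2)[OF sum_in_bigo(1)[OF f1 f2] f3])
  also have "(\<lambda>\<rho>. ((\<phi> (\<rho>\<^sup>2) 1 * (- of_real a22) - deriv01 (\<phi> (\<rho>\<^sup>2)) 1) - \<rho> * sin \<rho>)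
        + of_real (a12 - a21) - of_real (a12 * a21) * ivp_solution q (\<rho>\<^sup>2) 0 1 1) =
      (\<lambda>\<rho>. char_det q (form_mixed0 a11 a12) (form_mixed1 a21 a22) (\<rho>\<^sup>2) - \<rho> * sin \<rho>)"
    by (rule ext) (simp add: char_det_mixed[OF q] \<phi>_def algebra_simps)
  finally show ?thesis .
qed

text \<open>
  Equal lists of eigenvalues mean equal zeros with equal orders, and the determinants have the common
  leading term \<open>\<rho> * sin \<rho>\<close>, which also fixes the constant factor.
\<close>
lemma char_det_determined_by_eigenvalues:
  assumes q: "continuous_on {0..1} q" "continuous_on {0..1} qt"
    and ev: "eigenvalue_list q (form_mixed0 a11 a12) (form_mixed1 a21 a22) ev"
      "eigenvalue_list qt (form_mixed0 b11 b12) (form_mixed1 b21 b22) evt" "same_multiset ev evt"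
  shows "char_det q (form_mixed0 a11 a12) (form_mixed1 a21 a22) z =
         char_det qt (form_mixed0 b11 b12) (form_mixed1 b21 b22) z"
  using same_eigenvalue_lists[OF ev]
  by (intro sine_type_determined_by_zeros char_det_holomorphic char_det_asymptotics q)
     (simp_all add: eigenvalue_iff_char_det q)

section \<open>The inverse problem\<close>

text \<open>
  Expand \<open>\<phi>\<close> and \<open>\<phi>t\<close> in solutions with data at 1: the coefficients \<open>\<phi> 1\<close> and \<open>- W\<close> are common to both
  problems. The mixed Wronskians of \<open>(\<phi>, \<phi>t)\<close> with \<open>(\<psi>, \<psi>t)\<close> are therefore \<open>W\<close> times entire functions
  (\<open>PW1\<close>, \<open>PW2\<close>), and the division principle evaluates these as for two identical problems.
\<close>
lemma cauchy_data_determine_solution: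
  fixes q qt :: "real \<Rightarrow> real" and h ht H Ht :: complex
  assumes q: "continuous_on {0..1} q" "continuous_on {0..1} qt" and x: "x \<in> {0..1}"
  defines "\<phi> \<equiv> \<lambda>z. ivp_solution q z 1 h" and "\<phi>t \<equiv> \<lambda>z. ivp_solution qt z 1 ht"
  assumes 1: "\<And>z. \<phi> z 1 = \<phi>t z 1"
    and 2: "\<And>z. deriv01 (\<phi> z) 1 + H * \<phi> z 1 = deriv01 (\<phi>t z) 1 + Ht * \<phi>t z 1"
  shows "\<phi> z x = \<phi>t z x"
proof -
  define \<psi> \<psi>t s st where "\<psi> = (\<lambda>z. terminal_solution q z 1 (- H))" and "\<psi>t = (\<lambda>z. terminal_solution qt z 1 (- Ht))"
    and "s = (\<lambda>z. terminal_solution q z 0 1)" and "st = (\<lambda>z. terminal_solution qt z 0 1)"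
  define W where "W = (\<lambda>z. - (deriv01 (\<phi> z) 1 + H * \<phi> z 1))"
  have Wt: "W z = - (deriv01 (\<phi>t z) 1 + Ht * \<phi>t z 1)" for z
    by (simp add: W_def 2)
  have \<phi>: "solves q z (\<phi> z)" "solves qt z (\<phi>t z)" for z
    by (simp_all add: \<phi>_def \<phi>t_def ivp_solution q)
  have exp: "\<phi> z x = \<phi> z 1 * \<psi> z x - W z * s z x"
      "\<phi>t z x = \<phi> z 1 * \<psi>t z x - W z * st z x"
      "deriv01 (\<phi>t z) x = \<phi> z 1 * deriv01 (\<psi>t z) x - W z * deriv01 (st z) x" for z
  proof -
    have l: "solves q z (\<lambda>x. \<phi> z 1 * \<psi> z x + - W z * s z x)"
      "\<And>x. x \<in> {0..1} \<Longrightarrow> deriv01 (\<lambda>x. \<phi> z 1 * \<psi> z x + - W z * s z x) x =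
         \<phi> z 1 * deriv01 (\<psi> z) x + - W z * deriv01 (s z) x"
      using solves_linear[OF terminal_solution(1)[OF q(1), of z 1 "- H"] terminal_solution(1)[OF q(1), of z 0 1],
        where a = "\<phi> z 1" and b = "- W z"] unfolding \<psi>_def s_def .
    have lt: "solves qt z (\<lambda>x. \<phi> z 1 * \<psi>t z x + - W z * st z x)"
      "\<And>x. x \<in> {0..1} \<Longrightarrow> deriv01 (\<lambda>x. \<phi> z 1 * \<psi>t z x + - W z * st z x) x =
         \<phi> z 1 * deriv01 (\<psi>t z) x + - W z * deriv01 (st z) x"
      using solves_linear[OF terminal_solution(1)[OF q(2), of z 1 "- Ht"] terminal_solution(1)[OF q(2), of z 0 1],
        where a = "\<phi> z 1" and b = "- W z"] unfolding \<psi>t_def st_def .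
    have ends: "\<psi> z 1 = 1" "deriv01 (\<psi> z) 1 = - H" "s z 1 = 0" "deriv01 (s z) 1 = 1"
      "\<psi>t z 1 = 1" "deriv01 (\<psi>t z) 1 = - Ht" "st z 1 = 0" "deriv01 (st z) 1 = 1"
      unfolding \<psi>_def \<psi>t_def s_def st_def by (rule terminal_solution q)+
    have e: "\<phi> z 1 = \<phi> z 1 * \<psi> z 1 + - W z * s z 1"
      "deriv01 (\<phi> z) 1 = deriv01 (\<lambda>x. \<phi> z 1 * \<psi> z x + - W z * s z x) 1"
      by (simp add: ends) (subst l(2), simp_all add: ends W_def)
    have et: "\<phi>t z 1 = \<phi> z 1 * \<psi>t z 1 + - W z * st z 1"
      "deriv01 (\<phi>t z) 1 = deriv01 (\<lambda>x. \<phi> z 1 * \<psi>t z x + - W z * st z x) 1"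
      by (simp add: ends 1) (subst lt(2), simp_all add: ends Wt 1)
    show "\<phi> z x = \<phi> z 1 * \<psi> z x - W z * s z x"
      using solves_unique_terminal(1)[OF q(1) \<phi>(1) l(1) e x] by simp
    show "\<phi>t z x = \<phi> z 1 * \<psi>t z x - W z * st z x"
      using solves_unique_terminal(1)[OF q(2) \<phi>(2) lt(1) et x] by simp
    show "deriv01 (\<phi>t z) x = \<phi> z 1 * deriv01 (\<psi>t z) x - W z * deriv01 (st z) x"
      using solves_unique_terminal(2)[OF q(2) \<phi>(2) lt(1) et x] unfolding lt(2)[OF x] by simp
  qed
  have wr: "\<phi> z x * deriv01 (\<psi> z) x - deriv01 (\<phi> z) x * \<psi> z x = W z"
    "\<phi>t z x * deriv01 (\<psi>t z) x - deriv01 (\<phi>t z) x * \<psi>t z x = W z" for z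
  proof -
    show "\<phi> z x * deriv01 (\<psi> z) x - deriv01 (\<phi> z) x * \<psi> z x = W z"
      unfolding W_def \<phi>_def \<psi>_def left_right_wronskian[OF q(1) x] by simp
    show "\<phi>t z x * deriv01 (\<psi>t z) x - deriv01 (\<phi>t z) x * \<psi>t z x = W z"
      unfolding Wt \<phi>t_def \<psi>t_def left_right_wronskian[OF q(2) x] by simp
  qed
  have asy: "(\<lambda>\<rho>. W (\<rho>\<^sup>2) - \<rho> * sin \<rho>) \<in> O[at_infinity](growth 1)"
    unfolding wr(1)[symmetric] \<phi>_def \<psi>_def by (intro left_right_asymptotics q x)
  have asyt: "(\<lambda>\<rho>. \<phi> (\<rho>\<^sup>2) x * deriv01 (\<psi>t (\<rho>\<^sup>2)) x - deriv01 (\<phi>t (\<rho>\<^sup>2)) x * \<psi> (\<rho>\<^sup>2) x - \<rho> * sin \<rho>)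
       \<in> O[at_infinity](growth 1)"
    unfolding \<phi>_def \<psi>_def \<phi>t_def \<psi>t_def by (intro left_right_asymptotics q x)
  note hol = terminal_solution_holomorphic[OF q(1) x] terminal_solution_holomorphic[OF q(2) x]
  have PW1: "(\<psi> z x * deriv01 (st z) x - s z x * deriv01 (\<psi>t z) x - 1) * W z
            = \<phi> z x * deriv01 (\<psi>t z) x - deriv01 (\<phi>t z) x * \<psi> z x - W z" for z
    unfolding exp by (simp add: algebra_simps)
  have PW2: "(\<psi> z x * st z x - s z x * \<psi>t z x) * W z = \<phi> z x * \<psi>t z x - \<phi>t z x * \<psi> z x" for z
    unfolding exp by (simp add: algebra_simps)
  have P1: "\<psi> z x * deriv01 (st z) x - s z x * deriv01 (\<psi>t z) x - 1 = 0" for z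
  proof (rule entire_eq_0_by_sine_type_division[OF _ asy,
        where F = "\<lambda>z. \<psi> z x * deriv01 (st z) x - s z x * deriv01 (\<psi>t z) x - 1"])
    show "(\<lambda>z. \<psi> z x * deriv01 (st z) x - s z x * deriv01 (\<psi>t z) x - 1) holomorphic_on UNIV"
      unfolding \<psi>_def st_def s_def \<psi>t_def by (intro holomorphic_intros hol)
    show "(\<lambda>\<rho>. (\<psi> (\<rho>\<^sup>2) x * deriv01 (st (\<rho>\<^sup>2)) x - s (\<rho>\<^sup>2) x * deriv01 (\<psi>t (\<rho>\<^sup>2)) x - 1) * W (\<rho>\<^sup>2))
            \<in> O[at_infinity](growth 1)"
      unfolding PW1 using sum_in_bigo(2)[OF asyt asy] by (simp add: algebra_simps)
  qed
  have P2: "\<psi> z x * st z x - s z x * \<psi>t z x = 0" for z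
  proof (rule entire_eq_0_by_sine_type_division[OF _ asy,
        where F = "\<lambda>z. \<psi> z x * st z x - s z x * \<psi>t z x"])
    show "(\<lambda>z. \<psi> z x * st z x - s z x * \<psi>t z x) holomorphic_on UNIV"
      unfolding \<psi>_def st_def s_def \<psi>t_def by (intro holomorphic_intros hol)
    have x01: "0 \<le> x" "0 \<le> 1 - x" using x by auto
    have L: "(\<lambda>\<rho>. ivp_solution q' (\<rho>\<^sup>2) 1 c x) \<in> O[at_infinity](growth x)"
      if "continuous_on {0..1} q'" for q' c
      using sum_in_bigo(1)[OF growth_divide_bigo[OF ivp_solution_asymptotics(1)[OF that x, of 1 c]] cos_growth[OF x01(1)]]
      by simp
    have R: "(\<lambda>\<rho>. terminal_solution q' (\<rho>\<^sup>2) 1 c x) \<in> O[at_infinity](growth (1 - x))"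
      if "continuous_on {0..1} q'" for q' c
      using sum_in_bigo(1)[OF growth_divide_bigo[OF terminal_solution_asymptotics(1)[OF that x, of 1 c]] cos_growth[OF x01(2)]]
      by simp
    show "(\<lambda>\<rho>. (\<psi> (\<rho>\<^sup>2) x * st (\<rho>\<^sup>2) x - s (\<rho>\<^sup>2) x * \<psi>t (\<rho>\<^sup>2) x) * W (\<rho>\<^sup>2)) \<in> O[at_infinity](growth 1)"
      unfolding PW2 unfolding \<phi>_def \<phi>t_def \<psi>_def \<psi>t_def
      using landau_o.big.mult[OF L R] q by (intro sum_in_bigo) (simp_all add: growth_mult)
  qed
  have D0: "(\<phi> z x - \<phi>t z x) * W z = 0" for z
  proof -
    have a: "\<phi> z x * deriv01 (\<psi>t z) x - deriv01 (\<phi>t z) x * \<psi> z x = W z"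
      using PW1[of z] by (simp add: P1)
    have b: "\<phi> z x * \<psi>t z x - \<phi>t z x * \<psi> z x = 0"
      using PW2[of z] by (simp add: P2)
    \<comment> \<open>Write \<open>W\<close> in the first product as the Wronskian of \<open>\<phi>t\<close>, \<open>\<psi>t\<close> and in the second as the mixed one.\<close>
    have "(\<phi> z x - \<phi>t z x) * W z =
        \<phi> z x * (\<phi>t z x * deriv01 (\<psi>t z) x - deriv01 (\<phi>t z) x * \<psi>t z x)
        - \<phi>t z x * (\<phi> z x * deriv01 (\<psi>t z) x - deriv01 (\<phi>t z) x * \<psi> z x)"
      unfolding a wr(2) by (simp add: algebra_simps)
    also have "\<dots> = - deriv01 (\<phi>t z) x * (\<phi> z x * \<psi>t z x - \<phi>t z x * \<psi> z x)"
      by (simp add: algebra_simps)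
    finally show ?thesis by (simp only: b) simp
  qed
  have "\<phi> z x - \<phi>t z x = 0"
  proof (rule entire_eq_0_by_sine_type_division[OF _ asy, where F = "\<lambda>z. \<phi> z x - \<phi>t z x"])
    show "(\<lambda>z. \<phi> z x - \<phi>t z x) holomorphic_on UNIV"
      unfolding \<phi>_def \<phi>t_def by (intro holomorphic_intros ivp_solution_holomorphic q x)
    show "(\<lambda>\<rho>. (\<phi> (\<rho>\<^sup>2) x - \<phi>t (\<rho>\<^sup>2) x) * W (\<rho>\<^sup>2)) \<in> O[at_infinity](growth 1)"
      unfolding D0 by simp
  qed
  thus ?thesis by simp
qed

text \<open>
  Equal solutions have equal second derivatives, so \<open>(q x - qt x) * \<phi> z x = 0\<close> for every \<open>z\<close>, and for each
  \<open>x\<close> some \<open>z\<close> makes \<open>\<phi> z x\<close> nonzero.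
\<close>
lemma cauchy_data_determine_problem:
  fixes q qt :: "real \<Rightarrow> real" and h ht H Ht :: complex
  assumes q: "continuous_on {0..1} q" "continuous_on {0..1} qt"
  defines "\<phi> \<equiv> \<lambda>z. ivp_solution q z 1 h" and "\<phi>t \<equiv> \<lambda>z. ivp_solution qt z 1 ht"
  assumes 1: "\<And>z. \<phi> z 1 = \<phi>t z 1"
    and 2: "\<And>z. deriv01 (\<phi> z) 1 + H * \<phi> z 1 = deriv01 (\<phi>t z) 1 + Ht * \<phi>t z 1"
  shows "\<And>x. x \<in> {0..1} \<Longrightarrow> q x = qt x" and "h = ht" and "H = Ht"
proof -
  have eq: "\<phi> z x = \<phi>t z x" if "x \<in> {0..1}" for z x
    using cauchy_data_determine_solution[OF q that 1[unfolded \<phi>_def \<phi>t_def] 2[unfolded \<phi>_def \<phi>t_def]]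
    by (simp add: \<phi>_def \<phi>t_def)
  have eq': "deriv01 (\<phi> z) x = deriv01 (\<phi>t z) x" if "x \<in> {0..1}" for z x
    by (rule deriv01_cong[OF eq that])
  have \<phi>: "solves q z (\<phi> z)" "solves qt z (\<phi>t z)" for z
    by (simp_all add: \<phi>_def \<phi>t_def ivp_solution q)
  show "q x = qt x" if x: "x \<in> {0..1}" for x
  proof -
    obtain z where z: "\<phi> z x \<noteq> 0"
      using ivp_solution_not_identically_0[OF q(1) x] by (auto simp: \<phi>_def)
    have "(complex_of_real (q x) - z) * \<phi> z x = deriv01 (deriv01 (\<phi> z)) x"
      by (rule deriv01_eqI[OF x solves_derivs(2)[OF \<phi>(1) x], symmetric])
    also have "\<dots> = deriv01 (deriv01 (\<phi>t z)) x" by (rule deriv01_cong[OF eq' x])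
    also have "\<dots> = (complex_of_real (qt x) - z) * \<phi>t z x"
      by (rule deriv01_eqI[OF x solves_derivs(2)[OF \<phi>(2) x]])
    finally show ?thesis using z eq[OF x, of z] by simp
  qed
  show "h = ht" using eq'[of 0] by (simp add: \<phi>_def \<phi>t_def ivp_solution q)
  obtain z where "\<phi> z 1 \<noteq> 0" using ivp_solution_not_identically_0[OF q(1), of 1] by (auto simp: \<phi>_def)
  thus "H = Ht" using 1[of z] 2[of z] eq'[of 1 z] by simp
qed

lemma ivp_solution_cong:
  assumes "\<And>x. x \<in> {0..1} \<Longrightarrow> q x = qt x"
  shows "ivp_solution q z c d = ivp_solution qt z c d"
proof -
  have "solves q z = solves qt z" by (auto simp: fun_eq_iff solves_def assms)
  thus ?thesis by (simp add: ivp_solution_def)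
qed

lemma C1_unit_interval_continuous: "C1_unit_interval q \<Longrightarrow> continuous_on {0..1} q"
  unfolding C1_unit_interval_def
  by (meson DERIV_continuous continuous_on_eq_continuous_within)

theorem theorem1:
  fixes q qt :: "real \<Rightarrow> real"
    and a11 a12 a21 a22 at11 at12 at21 at22 :: real
    and ev ev1 ev2 evt evt1 evt2 :: "nat \<Rightarrow> complex"
  assumes "C1_unit_interval q" and "C1_unit_interval qt"
    and "eigenvalues_L q a11 a12 a21 a22 ev"
    and "eigenvalues_L1 q a11 a12 a21 a22 ev1"
    and "eigenvalues_L2 q a11 a12 a21 a22 ev2"
    and "eigenvalues_L qt at11 at12 at21 at22 evt"
    and "eigenvalues_L1 qt at11 at12 at21 at22 evt1"
    and "eigenvalues_L2 qt at11 at12 at21 at22 evt2"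
    and "same_multiset ev evt" and "same_multiset ev1 evt1" and "same_multiset ev2 evt2"
    and "a12 \<noteq> a22"
  shows "(\<forall>x\<in>{0..1}. q x = qt x) \<and>
         a11 = at11 \<and> a12 = at12 \<and> a21 = at21 \<and> a22 = at22"
proof -
  have q: "continuous_on {0..1} q" "continuous_on {0..1} qt"
    using assms(1,2) by (simp_all add: C1_unit_interval_continuous)
  define \<phi> \<phi>t where "\<phi> = (\<lambda>z. ivp_solution q z 1 (- of_real a11))"
    and "\<phi>t = (\<lambda>z. ivp_solution qt z 1 (- of_real at11))"
  note cd = char_det_mixed[OF q(1)] char_det_mixed[OF q(2)]
  have D: "- (deriv01 (\<phi> z) 1 + of_real a22 * \<phi> z 1) + of_real (a12 - a21) - of_real (a12 * a21) * ivp_solution q z 0 1 1 =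
           - (deriv01 (\<phi>t z) 1 + of_real at22 * \<phi>t z 1) + of_real (at12 - at21) - of_real (at12 * at21) * ivp_solution qt z 0 1 1" for z
    using char_det_determined_by_eigenvalues[OF q assms(3,6)[unfolded eigenvalues_L_def] assms(9), where z = z]
    unfolding cd \<phi>_def \<phi>t_def .
  have D1: "deriv01 (\<phi> z) 1 + of_real a22 * \<phi> z 1 = deriv01 (\<phi>t z) 1 + of_real at22 * \<phi>t z 1" for z
    using char_det_determined_by_eigenvalues[OF q
        assms(4,7)[unfolded eigenvalues_L1_def form_mixed_0[symmetric]] assms(10), where z = z]
    unfolding form_mixed_0 char_det_separated[OF q(1)] char_det_separated[OF q(2)] \<phi>_def \<phi>t_def
    by (simp only: neg_equal_iff_equal)
  have D2: "deriv01 (\<phi> z) 1 + of_real a12 * \<phi> z 1 = deriv01 (\<phi>t z) 1 + of_real at12 * \<phi>t z 1" for z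
    using char_det_determined_by_eigenvalues[OF q
        assms(5,8)[unfolded eigenvalues_L2_def form_mixed_0[symmetric]] assms(11), where z = z]
    unfolding form_mixed_0 char_det_separated[OF q(1)] char_det_separated[OF q(2)] \<phi>_def \<phi>t_def
    by (simp only: neg_equal_iff_equal)
  define k kt where "k = a22 - a12" and "kt = at22 - at12"
  have k: "of_real k * \<phi> z 1 = of_real kt * \<phi>t z 1" for z
  proof -
    have "of_real k * \<phi> z 1 = (deriv01 (\<phi> z) 1 + of_real a22 * \<phi> z 1) - (deriv01 (\<phi> z) 1 + of_real a12 * \<phi> z 1)"
      by (simp add: k_def algebra_simps)
    also have "\<dots> = of_real kt * \<phi>t z 1"
      unfolding D1 D2 by (simp add: kt_def algebra_simps)
    finally show ?thesis .
  qed
  \<comment> \<open>Both \<open>\<phi> z 1\<close> and \<open>\<phi>t z 1\<close> are \<open>cos \<rho>\<close> up to an error that vanishes along \<open>\<rho> = n\<close>, so if the factors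
    differed, \<open>cos n\<close> would tend to 0.\<close>
  have "k = kt"
  proof (rule ccontr)
    assume ne: "k \<noteq> kt"
    define r rt where "r = (\<lambda>\<rho>. \<phi> (\<rho>\<^sup>2) 1 - cos \<rho>)" and "rt = (\<lambda>\<rho>. \<phi>t (\<rho>\<^sup>2) 1 - cos \<rho>)"
    have "r \<in> O[at_infinity](\<lambda>\<rho>. growth 1 \<rho> / \<rho>)" "rt \<in> O[at_infinity](\<lambda>\<rho>. growth 1 \<rho> / \<rho>)"
      using ivp_solution_asymptotics(1)[OF q(1), of 1 1 "- of_real a11"]
        ivp_solution_asymptotics(1)[OF q(2), of 1 1 "- of_real at11"]
      by (simp_all add: r_def rt_def \<phi>_def \<phi>t_def)
    note lim = this[THEN bigo_growth_real_tendsto_0]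
    have "(\<lambda>n. (of_real kt * rt (of_nat n) - of_real k * r (of_nat n)) / of_real (k - kt))
             \<longlonglongrightarrow> (of_real kt * 0 - of_real k * 0) / of_real (k - kt)"
      using ne by (intro tendsto_intros lim) auto
    moreover have "(of_real kt * rt \<rho> - of_real k * r \<rho>) / of_real (k - kt) = cos \<rho>" for \<rho>
    proof -
      have "of_real kt * rt \<rho> - of_real k * r \<rho> = of_real (k - kt) * cos \<rho>"
        using k[of "\<rho>\<^sup>2"] by (simp add: r_def rt_def algebra_simps)
      thus ?thesis using ne by simp
    qed
    ultimately show False using cos_not_tendsto_0[of 1] by simp
  qed
  hence "\<phi> z 1 = \<phi>t z 1" for z using k[of z] assms(12) by (simp add: k_def)
  note res = cauchy_data_determine_problem[OF q this[unfolded \<phi>_def \<phi>t_def] D1[unfolded \<phi>_def \<phi>t_def]]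
  have a11: "a11 = at11" using res(2) by simp
  have a22: "a22 = at22" using res(3) by simp
  have a12: "a12 = at12" using \<open>k = kt\<close> a22 by (simp add: k_def kt_def)
  have Sq: "ivp_solution q z 0 1 = ivp_solution qt z 0 1" for z
    by (rule ivp_solution_cong) (rule res(1))
  define S where "S = (\<lambda>z. ivp_solution q z 0 1 1)"
  have "(of_real a21 - of_real at21) * (1 + of_real a12 * S z) = 0" for z
  proof -
    have "of_real (a12 - a21) - of_real (a12 * a21) * S z = of_real (a12 - at21) - of_real (a12 * at21) * S z"
      using D[of z] unfolding D1 a12[symmetric] Sq[symmetric] S_def
      by (simp add: algebra_simps)
    thus ?thesis by (simp add: algebra_simps)
  qed
  moreover have "\<exists>z. 1 + of_real a12 * S z \<noteq> 0"
  proof (rule ccontr)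
    assume "\<not> ?thesis"
    hence S: "1 + of_real a12 * S z = 0" for z by blast
    have "(\<lambda>\<rho>. S (\<rho>\<^sup>2)) \<in> O[at_infinity](\<lambda>\<rho>. growth 1 \<rho> / \<rho>)"
      using ivp_solution_asymptotics(1)[OF q(1), of 1 0 1] by (simp add: S_def)
    from bigo_growth_real_tendsto_0[OF this]
    have "(\<lambda>n. 1 + of_real a12 * S ((of_nat n)\<^sup>2)) \<longlonglongrightarrow> 1 + of_real a12 * 0"
      by (intro tendsto_intros)
    thus False unfolding S by (simp add: LIMSEQ_const_iff)
  qed
  ultimately have "a21 = at21" by (metis eq_iff_diff_eq_0 mult_eq_0_iff of_real_eq_iff)
  with res(1) a11 a12 a22 show ?thesis by blast
qed

end
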